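(* There are polynomials $P^{(a)}_{\lambda,\eta}(\partial_s,\partial_r)$ and $P^{(b)}_{\lambda,\eta}(\partial_s,\partial_r)$ in $\partial_s,\partial_r$, with coefficients in the ring $\mathbb{Q}[r]$, indexed by integer partitions $\lambda,\eta$, such that the continuum string equations can be expressed as $$0 \sim \sum_{\lambda,\eta} \partial_n^{\lambda}s\;\partial_n^{\eta}r\; P^{(a)}_{\lambda,\eta}(\partial_s,\partial_r)\cdot [h^0]\,V'(h+s+rh^{-1}),$$ $$x \sim \sum_{\lambda,\eta} \partial_n^{\lambda}s\;\partial_n^{\eta}r\; P^{(b)}_{\lambda,\eta}(\partial_s,\partial_r)\cdot [h^0]\,V'(h+s+rh^{-1}).$$ The polynomials $P^{(a)}_{\lambda,\eta}$ and $P^{(b)}_{\lambda,\eta}$ (the string polynomials) do not depend on the potential $V$. Furthermore, they can be chosen to have polynomial degree at most one in $\partial_r$, and are uniquely determined by this condition.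
   Context: The potential is $V(\lambda)=\frac12\lambda^2+\sum_{j=1}^d t_j\lambda^j$. Let $p_n=p_{n,N}$ be the monic orthogonal polynomials for the weight $e^{-NV(\lambda)}\,d\lambda$, with three term recurrence $\lambda p_n=p_{n+1}+s_{n,N}p_n+r_{n,N}p_{n-1}$. Let $L$ be the tridiagonal Jacobi matrix, rows and columns indexed by $n\ge 0$, with $L_{n,n}=s_{n,N}$, $L_{n,n+1}=1$, $L_{n,n-1}=r_{n,N}$ and all other entries $0$. The string equations are $0=V'(L)_{n,n}$ and $n/N=V'(L)_{n,n-1}$. Write $x=n/N$ and $\partial_n=N^{-1}\partial_x$. Let $r=\sum_{g\ge0}z_g(x)N^{-2g}$ and $s=\sum_{g\ge 0}u_g(x)N^{-g}$ be the formal series for the asymptotic expansions of $r_{n,N}$ and $s_{n,N}$ as $n,N\to\infty$ with $n/N=x$ fixed. The index-shifted coefficients have the expansions $r_{n+k,N}\sim e^{k\partial_n}r=\sum_{m\ge0}\frac{k^m}{m!}\partial_n^m r$ and $s_{n+k,N}\sim e^{k\partial_n}s=\sum_{m\ge0}\frac{k^m}{m!}\partial_n^m s$. The continuum string equations (continuum string hierarchy) are obtained by inserting these expansions in the string equations $0=V'(L)_{n,n}$ and $x=V'(L)_{n,n-1}$. The symbol $\sim$ means equality as asymptotic series in powers of $N^{-1}$. For an integer partition $\lambda=(\lambda_1,\dots,\lambda_l)$, $\partial_n^{\lambda}f:=\prod_{i=1}^{l}\partial_n^{\lambda_i}f$ (equal to $1$ for the empty partition). The sums run over all pairs of integer partitions,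 including the empty ones. $[h^p]G(h)$ denotes the coefficient of $h^p$ in a Laurent series $G$ in powers of $h$. The operators $P_{\lambda,\eta}(\partial_s,\partial_r)$ act on the polynomial $[h^0]V'(h+s+rh^{-1})$ in the variables $s,r$.
   Formalization: In the second equation the term λ=η=∅ acts on [h^0]V, not [h^0]V' (no polynomial operator on V' works). Degree at most one in ∂_r is claimed, with uniqueness, over Q[r,1/r]; over Q[r] only without degree bound. z_0(x)≠0 is assumed. *)

theory Defs
  imports
    "HOL-Analysis.Analysis"
    "HOL-Library.Poly_Mapping"
    "HOL-Library.Multiset"
    "HOL-Computational_Algebra.Computational_Algebra"
begin

section \<open>The potential\<close>

definition potential :: "nat \<Rightarrow> (nat \<Rightarrow> real) \<Rightarrow> real poly" where
  "potential d t = monom (1/2) 2 + (\<Sum>j=1..d. monom (t j) j)"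


section \<open>Jacobi matrices\<close>

definition jacobi_matrix :: "(nat \<Rightarrow> 'a::comm_ring_1) \<Rightarrow> (nat \<Rightarrow> 'a) \<Rightarrow> nat \<Rightarrow> nat \<Rightarrow> 'a" where
  "jacobi_matrix s r i j =
     (if j = i then s i else if j = i + 1 then 1 else if i = j + 1 then r i else 0)"

text \<open>Infinite matrices are only multiplied when the rows of the left factor have finite support.\<close>

definition row_finite_mult ::
    "(nat \<Rightarrow> nat \<Rightarrow> 'a::comm_ring_1) \<Rightarrow> (nat \<Rightarrow> nat \<Rightarrow> 'a) \<Rightarrow> nat \<Rightarrow> nat \<Rightarrow> 'a" where
  "row_finite_mult A B i j = (\<Sum>k | A i k \<noteq> 0. A i k * B k j)"

primrec row_finite_power :: "(nat \<Rightarrow> nat \<Rightarrow> 'a::comm_ring_1) \<Rightarrow> nat \<Rightarrow> nat \<Rightarrow> nat \<Rightarrow> 'a" where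
  "row_finite_power A 0 = (\<lambda>i j. if i = j then 1 else 0)"
| "row_finite_power A (Suc m) = row_finite_mult A (row_finite_power A m)"

definition poly_of_matrix :: "'a::comm_ring_1 poly \<Rightarrow> (nat \<Rightarrow> nat \<Rightarrow> 'a) \<Rightarrow> nat \<Rightarrow> nat \<Rightarrow> 'a" where
  "poly_of_matrix W A i j = (\<Sum>m\<le>degree W. coeff W m * row_finite_power A m i j)"


section \<open>Expansions in powers of \<open>1/N\<close>\<close>

text \<open>
  A series \<open>\<Sum>j. f j x * N^(-j)\<close> with coefficients depending on \<open>x = n/N\<close> is given by
  \<open>f :: nat \<Rightarrow> real \<Rightarrow> real\<close>; for fixed \<open>x\<close> it is an element of \<^typ>\<open>real fps\<close> whose formal
  variable \<^const>\<open>fps_X\<close> is \<open>1/N\<close>. The operator \<open>\<partial>\<^sub>n = (1/N) d/dx\<close> acts coefficientwise, so its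
  \<open>m\<close>-th power is multiplication by \<open>fps_X ^ m\<close> after taking \<open>m\<close>-th derivatives of all coefficients.
\<close>

definition dn :: "nat \<Rightarrow> (nat \<Rightarrow> real \<Rightarrow> real) \<Rightarrow> real \<Rightarrow> real fps" where
  "dn m f x = fps_X ^ m * Abs_fps (\<lambda>j. (deriv ^^ m) (f j) x)"

text \<open>
  \<open>exp (k \<partial>\<^sub>n) f\<close>. The \<open>m\<close>-th term is divisible by \<open>N^(-m)\<close>, so the series converges in the
  topology of \<^typ>\<open>real fps\<close>, where convergence means that each coefficient is eventually constant.
\<close>

definition index_shift :: "int \<Rightarrow> (nat \<Rightarrow> real \<Rightarrow> real) \<Rightarrow> real \<Rightarrow> real fps" where
  "index_shift k f x = suminf (\<lambda>m. fps_const (of_int k ^ m / fact m) * dn m f x)"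

text \<open>The expansion \<open>r = \<Sum>g. z g x * N^(-2g)\<close> has only even powers.\<close>

definition even_series :: "(nat \<Rightarrow> real \<Rightarrow> real) \<Rightarrow> nat \<Rightarrow> real \<Rightarrow> real" where
  "even_series z j = (if even j then z (j div 2) else (\<lambda>x. 0))"

text \<open>
  The Jacobi matrix with the index-shifted expansions inserted: the base index \<open>n\<close> corresponds to
  the point \<open>x\<close>, and the row \<open>n + k\<close> carries the expansions of \<open>s\<^sub>n\<^sub>+\<^sub>k\<close> and \<open>r\<^sub>n\<^sub>+\<^sub>k\<close>.
\<close>

definition continuum_jacobi ::
    "(nat \<Rightarrow> real \<Rightarrow> real) \<Rightarrow> (nat \<Rightarrow> real \<Rightarrow> real) \<Rightarrow> real \<Rightarrow> nat \<Rightarrow> nat \<Rightarrow> nat \<Rightarrow> real fps" where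
  "continuum_jacobi u z x n =
     jacobi_matrix (\<lambda>i. index_shift (int i - int n) u x)
                   (\<lambda>i. index_shift (int i - int n) (even_series z) x)"

definition continuum_entry ::
    "real poly \<Rightarrow> (nat \<Rightarrow> real \<Rightarrow> real) \<Rightarrow> (nat \<Rightarrow> real \<Rightarrow> real) \<Rightarrow> real \<Rightarrow> nat \<Rightarrow> nat \<Rightarrow> nat \<Rightarrow> real fps" where
  "continuum_entry V u z x n =
     poly_of_matrix (map_poly fps_const (pderiv V)) (continuum_jacobi u z x n)"

text \<open>
  The string equations are used for \<open>n \<rightarrow> \<infinity>\<close>; for \<open>n > degree V\<close> the entries below do not see the
  boundary of the matrix and do not depend on \<open>n\<close>.
\<close>

definition continuum_string_equations ::
    "real poly \<Rightarrow> (nat \<Rightarrow> real \<Rightarrow> real) \<Rightarrow> (nat \<Rightarrow> real \<Rightarrow> real) \<Rightarrow> real \<Rightarrow> bool" where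
  "continuum_string_equations V u z x \<longleftrightarrow>
     (\<forall>n>degree V. 0 = continuum_entry V u z x n n n
                 \<and> fps_const x = continuum_entry V u z x n n (n - 1))"

text \<open>
  The leading order \<open>x = [h\<^sup>-\<^sup>1] V'(h + u\<^sub>0 + z\<^sub>0 h\<^sup>-\<^sup>1)\<close> of the second string equation is divisible
  by \<open>z\<^sub>0\<close>, so \<open>z\<^sub>0 x \<noteq> 0\<close> is automatic for solutions with \<open>x \<noteq> 0\<close>. It makes the series \<open>r\<close>
  invertible.
\<close>

definition admissible ::
    "real poly \<Rightarrow> (nat \<Rightarrow> real \<Rightarrow> real) \<Rightarrow> (nat \<Rightarrow> real \<Rightarrow> real) \<Rightarrow> real \<Rightarrow> bool" where
  "admissible V u z x \<longleftrightarrow>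
     (\<exists>d t. V = potential d t) \<and>
     (\<exists>X. open X \<and> x \<in> X \<and>
        (\<forall>g m. \<forall>y\<in>X. (deriv ^^ m) (u g) differentiable at y
                    \<and> (deriv ^^ m) (z g) differentiable at y)) \<and>
     z 0 x \<noteq> 0"


section \<open>Coefficient extraction\<close>

text \<open>
  Polynomials in \<open>s\<close> and \<open>r\<close> are elements of \<^typ>\<open>real poly poly\<close>, with \<open>s\<close> the outer and \<open>r\<close> the
  inner variable. The following is \<open>[h\<^sup>0] W(h + s + r h\<^sup>-\<^sup>1)\<close>.
\<close>

definition central_coeff :: "real poly \<Rightarrow> real poly poly" where
  "central_coeff W = fls_nth
     (poly (map_poly (\<lambda>c. fls_const [:[:c:]:]) W)
        (fls_X + fls_const [:0, 1:] + fls_const [:[:0, 1:]:] * fls_X_inv)) 0"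

abbreviation d_s :: "real poly poly \<Rightarrow> real poly poly" where
  "d_s G \<equiv> pderiv G"

abbreviation d_r :: "real poly poly \<Rightarrow> real poly poly" where
  "d_r G \<equiv> map_poly pderiv G"

definition eval_sr :: "real poly poly \<Rightarrow> real fps \<Rightarrow> real fps \<Rightarrow> real fps" where
  "eval_sr G \<sigma> \<rho> = poly (map_poly (\<lambda>c. poly (map_poly fps_const c) \<rho>) G) \<sigma>"


section \<open>Polynomials in \<open>\<partial>\<^sub>s\<close> and \<open>\<partial>\<^sub>r\<close>\<close>

text \<open>
  The group algebra \<^typ>\<open>int \<Rightarrow>\<^sub>0 rat\<close> is the ring of Laurent polynomials in \<open>r\<close>; the polynomial
  ring in \<open>r\<close> is its subring of elements without negative exponents. In \<open>diff_op\<close> the outer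
  variable is \<open>\<partial>\<^sub>r\<close>, so that \<^const>\<open>degree\<close> is the degree in \<open>\<partial>\<^sub>r\<close>, and the inner one is \<open>\<partial>\<^sub>s\<close>.
  Coefficients stand to the left of the derivatives.

  Negative powers of \<open>r\<close> enter only through the reduction to degree at most one in \<open>\<partial>\<^sub>r\<close>: for
  \<open>F = [h\<^sup>0] V'(h + s + r h\<^sup>-\<^sup>1)\<close> one has \<open>r \<partial>\<^sub>r\<^sup>2 F = (\<partial>\<^sub>s\<^sup>2 - \<partial>\<^sub>r) F\<close>, and the reduction divides
  by \<open>r\<close>.
\<close>

type_synonym diff_op = "(int \<Rightarrow>\<^sub>0 rat) poly poly"

definition polynomial_coeffs :: "diff_op \<Rightarrow> bool" where
  "polynomial_coeffs P \<longleftrightarrow>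
     (\<forall>a b. \<forall>k \<in> Poly_Mapping.keys (coeff (coeff P b) a). 0 \<le> k)"

definition laurent_eval :: "(int \<Rightarrow>\<^sub>0 rat) \<Rightarrow> real fps \<Rightarrow> real fps" where
  "laurent_eval c \<rho> =
     (\<Sum>k\<in>Poly_Mapping.keys c. fps_const (of_rat (Poly_Mapping.lookup c k)) * \<rho> powi k)"

text \<open>The result of applying \<open>P\<close> to \<open>G\<close>, evaluated at \<open>s = \<sigma>\<close> and \<open>r = \<rho>\<close>.\<close>

definition apply_op :: "diff_op \<Rightarrow> real poly poly \<Rightarrow> real fps \<Rightarrow> real fps \<Rightarrow> real fps" where
  "apply_op P G \<sigma> \<rho> =
     (\<Sum>b\<le>degree P. \<Sum>a\<le>degree (coeff P b).
        laurent_eval (coeff (coeff P b) a) \<rho> * eval_sr ((d_s ^^ a) ((d_r ^^ b) G)) \<sigma> \<rho>)"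


section \<open>String polynomials\<close>

definition int_partitions :: "nat multiset set" where
  "int_partitions = {p. 0 \<notin># p}"

definition dn_partition :: "nat multiset \<Rightarrow> (nat \<Rightarrow> real \<Rightarrow> real) \<Rightarrow> real \<Rightarrow> real fps" where
  "dn_partition p f x = (\<Prod>m\<in>#p. dn m f x)"

type_synonym op_family = "nat multiset \<Rightarrow> nat multiset \<Rightarrow> diff_op"

text \<open>Families indexed by pairs of partitions, made total by the value \<open>0\<close>.\<close>

definition partition_indexed :: "op_family \<Rightarrow> bool" where
  "partition_indexed P \<longleftrightarrow>
     (\<forall>p q. (p, q) \<notin> int_partitions \<times> int_partitions \<longrightarrow> P p q = 0)"

definition string_summand ::
    "op_family \<Rightarrow> (nat multiset \<Rightarrow> nat multiset \<Rightarrow> real poly poly)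
      \<Rightarrow> (nat \<Rightarrow> real \<Rightarrow> real) \<Rightarrow> (nat \<Rightarrow> real \<Rightarrow> real) \<Rightarrow> real
      \<Rightarrow> nat multiset \<times> nat multiset \<Rightarrow> real fps" where
  "string_summand P G u z x = (\<lambda>(p, q).
     dn_partition p u x * dn_partition q (even_series z) x
       * apply_op (P p q) (G p q) (dn 0 u x) (dn 0 (even_series z) x))"

definition operand_a :: "real poly \<Rightarrow> nat multiset \<Rightarrow> nat multiset \<Rightarrow> real poly poly" where
  "operand_a V p q = central_coeff (pderiv V)"

text \<open>
  The leading term of the second equation is
  \<open>[h\<^sup>-\<^sup>1] V'(h + s + r h\<^sup>-\<^sup>1) = r \<partial>\<^sub>r [h\<^sup>0] V(h + s + r h\<^sup>-\<^sup>1)\<close>. It is \<open>r \<partial>\<^sub>r \<partial>\<^sub>s\<^sup>-\<^sup>1\<close> applied to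
  \<open>[h\<^sup>0] V'(h + s + r h\<^sup>-\<^sup>1)\<close>, and no polynomial in \<open>\<partial>\<^sub>s\<close>, \<open>\<partial>\<^sub>r\<close> independent of \<open>V\<close> does the same.
  So the factor \<open>\<partial>\<^sub>s\<^sup>-\<^sup>1\<close>, which replaces \<open>V'\<close> by \<open>V\<close>, is admitted for the pair of empty partitions.
\<close>

definition operand_b :: "real poly \<Rightarrow> nat multiset \<Rightarrow> nat multiset \<Rightarrow> real poly poly" where
  "operand_b V p q =
     (if p = {#} \<and> q = {#} then central_coeff V else central_coeff (pderiv V))"

definition string_expansion_a :: "op_family \<Rightarrow> bool" where
  "string_expansion_a P \<longleftrightarrow>
     (\<forall>V u z x. admissible V u z x \<longrightarrow>
       (\<forall>n>degree V. (string_summand P (operand_a V) u z x has_sum continuum_entry V u z x n n n)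
          (int_partitions \<times> int_partitions)))"

definition string_expansion_b :: "op_family \<Rightarrow> bool" where
  "string_expansion_b P \<longleftrightarrow>
     (\<forall>V u z x. admissible V u z x \<longrightarrow>
       (\<forall>n>degree V. (string_summand P (operand_b V) u z x has_sum continuum_entry V u z x n n (n - 1))
          (int_partitions \<times> int_partitions)))"

end

theory Submission
  imports Defs
begin

text \<open>
  An entry of \<open>L\<^sup>m\<close> is a sum over lattice paths, in which a step at height \<open>k\<close> has the weight
  \<open>\<Sum>\<^sub>j k\<^sup>j/j! \<partial>\<^sub>n\<^sup>j s\<close> or \<open>\<Sum>\<^sub>j k\<^sup>j/j! \<partial>\<^sub>n\<^sup>j r\<close>. Marking the steps with \<open>j > 0\<close> turns the coefficient of
  \<open>\<partial>\<^sub>n\<^sup>\<lambda> s \<partial>\<^sub>n\<^sup>\<eta> r\<close> into a product of resolvents of \<open>\<ell> = h + s + r/h\<close>, interrupted by \<open>D\<^sup>j/j!\<close> and \<open>h\<^sup>-\<^sup>1 D\<^sup>j/j!\<close>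
  with \<open>D = h d/dh\<close>. Commuting the resolvents to one side yields terms \<open>r\<^sup>b h\<^sup>e (d/d\<ell>)\<^sup>i \<ell>\<^sup>m\<close> with \<open>\<bar>e\<bar> \<le> i\<close>, independent of
  \<open>m\<close>. Their constant terms in \<open>h\<close> are obtained from that of \<open>\<ell>\<^sup>m\<close> by operators in \<open>\<partial>\<^sub>s\<close>, \<open>\<partial>\<^sub>r\<close>, because \<open>\<partial>\<^sub>s\<close> acts as
  \<open>d/d\<ell>\<close>, \<open>\<partial>\<^sub>r\<close> as \<open>h\<^sup>-\<^sup>1 d/d\<ell>\<close>, and \<open>h \<mapsto> r/h\<close> preserves \<open>\<ell>\<close>.

  Integration by parts in \<open>h\<close> lowers the degree in \<open>\<partial>\<^sub>r\<close> to one at the cost of negative powers of \<open>r\<close>. For uniqueness,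
  arbitrary jets of \<open>s\<close> and \<open>r\<close> separate the partitions, and on the powers of \<open>\<lambda>\<close> the operators \<open>\<partial>\<^sub>s\<^sup>a\<close> and \<open>\<partial>\<^sub>s\<^sup>a \<partial>\<^sub>r\<close>
  are linearly independent.
\<close>

section \<open>Trinomial coefficients\<close>

text \<open>The coefficient of \<open>h^c\<close> in \<open>(h + s + r/h)^m\<close>. The ring is
  kept general because it is used with polynomials in \<open>s\<close> and \<open>r\<close>, with
  power series and with reals.\<close>

primrec tri :: "'a::comm_ring_1 \<Rightarrow> 'a \<Rightarrow> nat \<Rightarrow> int \<Rightarrow> 'a" where
  "tri s r 0 = (\<lambda>c. if c = 0 then 1 else 0)"
| "tri s r (Suc m) = (\<lambda>c. tri s r m (c - 1) + s * tri s r m c + r * tri s r m (c + 1))"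

text \<open>The substitution of \<open>r/h\<close> for \<open>h\<close> fixes
  \<open>h + s + r/h\<close> and sends \<open>h^c\<close> to \<open>r^c h^(-c)\<close>.\<close>

lemma tri_minus: "tri s r m (- int c) = r ^ c * tri s r m (int c)"
proof (induction m arbitrary: c)
  case 0
  then show ?case by (cases c) auto
next
  case (Suc m)
  show ?case
  proof (cases c)
    case 0
    then show ?thesis by simp
  next
    case (Suc k)
    have "- int c - 1 = - int (Suc c)" "- int c + 1 = - int k" "int c - 1 = int k"
      "int c + 1 = int (Suc c)"
      using Suc by auto
    moreover have "r ^ c = r * r ^ k"
      using Suc by simp
    ultimately show ?thesis
      using Suc.IH[of "Suc c"] Suc.IH[of c] Suc.IH[of k]
      by (simp only: tri.simps) (simp add: algebra_simps)
  qed
qed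

text \<open>Compare the coefficients of \<open>h^c\<close> in
  \<open>D \<ell>^(m+1) = (m+1) \<ell>^m (h - r/h)\<close>, where \<open>D = h d/dh\<close>
  multiplies such a coefficient by \<open>c\<close>.\<close>

lemma tri_index:
  "of_int c * tri s r (Suc m) c = of_nat (Suc m) * (tri s r m (c - 1) - r * tri s r m (c + 1))"
proof (induction m arbitrary: c)
  case 0
  have "c + 1 = 0 \<longleftrightarrow> c = - 1"
    by auto
  then show ?case by auto
next
  case (Suc m)
  define T where "T = tri s r (Suc m)"
  have T: "T c = tri s r m (c - 1) + s * tri s r m c + r * tri s r m (c + 1)" for c
    by (simp add: T_def)
  have IH: "of_int c * T c = of_nat (Suc m) * (tri s r m (c - 1) - r * tri s r m (c + 1))" for c
    using Suc.IH[of c] by (simp add: T_def)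
  have a: "of_int c * T (c - 1) = of_int (c - 1) * T (c - 1) + T (c - 1)"
    "of_int c * T (c + 1) = of_int (c + 1) * T (c + 1) - T (c + 1)"
    by (simp_all add: algebra_simps)
  have "of_int c * tri s r (Suc (Suc m)) c
      = of_int c * T (c - 1) + s * (of_int c * T c) + r * (of_int c * T (c + 1))"
    by (subst tri.simps(2), fold T_def) (simp add: algebra_simps)
  also have "\<dots> = of_nat (Suc m) * (T (c - 1) - r * T (c + 1)) + T (c - 1) - r * T (c + 1)"
    unfolding a IH unfolding T by (simp add: algebra_simps)
  also have "\<dots> = of_nat (Suc (Suc m)) * (T (c - 1) - r * T (c + 1))"
    by (simp add: algebra_simps)
  finally show ?case by (simp only: T_def)
qed

text \<open>
  \<open>dtri s r j m c\<close> is the coefficient of \<open>h\<^sup>c\<close> in \<open>1/j! (d/d\<ell>)\<^sup>j \<ell>\<^sup>m\<close> for \<open>\<ell> = h + s + r/h\<close>, which is also the coefficient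
  of \<open>\<zeta>\<^sup>-\<^sup>m\<^sup>-\<^sup>1\<close> in the power \<open>(\<zeta> - \<ell>)\<^sup>-\<^sup>j\<^sup>-\<^sup>1\<close> of the resolvent.
\<close>

definition dtri :: "'a::comm_ring_1 \<Rightarrow> 'a \<Rightarrow> nat \<Rightarrow> nat \<Rightarrow> int \<Rightarrow> 'a" where
  "dtri s r j m c = of_nat (m choose j) * tri s r (m - j) c"

lemma dtri_0: "dtri s r 0 m c = tri s r m c"
  by (simp add: dtri_def)

lemma dtri_eq_0: "m < j \<Longrightarrow> dtri s r j m c = 0"
  by (simp add: dtri_def binomial_eq_0)

text \<open>Leibniz rule for the derivatives of \<open>\<ell> * \<ell>^m\<close> in
  \<open>\<ell>\<close>: order \<open>Suc j\<close> obeys the recursion of \<open>tri\<close> with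
  order \<open>j\<close> as a source term.\<close>

lemma dtri_Suc_Suc:
  "dtri s r (Suc j) (Suc m) c
   = dtri s r (Suc j) m (c - 1) + s * dtri s r (Suc j) m c + r * dtri s r (Suc j) m (c + 1)
     + dtri s r j m c"
proof (cases "j < m")
  case True
  then obtain k where k: "m - j = Suc k" "m - Suc j = k"
    by (metis Suc_diff_Suc)
  show ?thesis
    unfolding dtri_def by (simp add: k algebra_simps)
next
  case False
  then show ?thesis
    by (auto simp: dtri_def binomial_eq_0)
qed

lemma dtri_minus: "dtri s r j m (- int c) = r ^ c * dtri s r j m (int c)"
  by (simp add: dtri_def tri_minus algebra_simps)

lemma choose_mult_diff: "(m choose j) * (m - j) = Suc j * (m choose Suc j)"
  by (metis binomial_absorb_comp binomial_absorption mult.commute)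

text \<open>\<open>D\<close> acts as \<open>(h - r/h) d/d\<ell>\<close> and so raises the order by
  one; the normalisation by \<open>j!\<close> leaves the factor \<open>Suc j\<close>.\<close>

lemma dtri_index:
  "of_int c * dtri s r j m c
   = of_nat (Suc j) * (dtri s r (Suc j) m (c - 1) - r * dtri s r (Suc j) m (c + 1))"
proof (cases "j < m")
  case True
  then obtain k where k: "m - j = Suc k" "m - Suc j = k"
    by (metis Suc_diff_Suc)
  define X where "X = tri s r k (c - 1) - r * tri s r k (c + 1)"
  have "of_int c * dtri s r j m c = of_nat (m choose j) * (of_int c * tri s r (Suc k) c)"
    unfolding dtri_def k by (simp only: mult.left_commute)
  also have "\<dots> = of_nat ((m choose j) * (m - j)) * X"
    unfolding tri_index X_def k by (simp only: of_nat_mult mult.assoc)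
  also have "\<dots> = of_nat (Suc j) * (of_nat (m choose Suc j) * X)"
    unfolding choose_mult_diff by (simp only: of_nat_mult mult.assoc)
  finally show ?thesis
    unfolding dtri_def k X_def by (simp only: right_diff_distrib mult.left_commute)
next
  case False
  then show ?thesis
    by (cases "m = j") (auto simp: dtri_def binomial_eq_0)
qed

lemma fls_nth_trinomial_power:
  "fls_nth ((fls_X + fls_const s + fls_const r * fls_X_inv) ^ m) c = tri s r m c"
proof (induction m arbitrary: c)
  case 0
  then show ?case by simp
next
  case (Suc m)
  define Y where "Y = fls_X + fls_const s + fls_const r * fls_X_inv"
  have "Y ^ Suc m = fls_X * Y ^ m + fls_const s * Y ^ m + fls_const r * (fls_X_inv * Y ^ m)"
    unfolding power_Suc by (subst Y_def) (simp add: distrib_right mult.assoc)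
  then show ?case
    using Suc by (simp add: Y_def fls_X_times_conv_shift fls_X_inv_times_conv_shift)
qed

lemma central_coeff_conv_tri:
  "central_coeff W = (\<Sum>m\<le>degree W. [:[:coeff W m:]:] * tri [:0, 1:] [:[:0, 1:]:] m 0)"
proof -
  let ?f = "\<lambda>c::real. fls_const [:[:c:]:]"
  let ?Y = "fls_X + fls_const [:0, 1:] + fls_const [:[:0, 1::real:]:] * fls_X_inv"
  have "poly (map_poly ?f W) ?Y = (\<Sum>m\<le>degree (map_poly ?f W). coeff (map_poly ?f W) m * ?Y ^ m)"
    by (rule poly_altdef)
  also have "degree (map_poly ?f W) = degree W"
    by (rule degree_map_poly) (simp add: fls_const_nonzero)
  also have "(\<Sum>m\<le>degree W. coeff (map_poly ?f W) m * ?Y ^ m)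
    = (\<Sum>m\<le>degree W. ?f (coeff W m) * ?Y ^ m)"
    by (simp add: coeff_map_poly)
  finally show ?thesis
    unfolding central_coeff_def
    by (simp add: fls_nth_sum fls_nth_trinomial_power)
qed

section \<open>Derivatives in \<open>s\<close> and \<open>r\<close>\<close>

lemma d_r_add: "d_r (p + q) = d_r p + d_r q"
  by (intro poly_eqI) (simp add: coeff_map_poly pderiv_add)

lemma d_r_smult: "d_r (smult a p) = smult (pderiv a) p + smult a (d_r p)"
  by (intro poly_eqI) (simp add: coeff_map_poly pderiv_mult algebra_simps)

lemma d_s_tri: "d_s (tri [:0, 1:] [:[:0, 1:]:] (Suc m) c)
    = of_nat (Suc m) * tri [:0, 1:] [:[:0, 1:]:] m c"
proof (induction m arbitrary: c)
  case 0
  then show ?case by (auto simp: pderiv_add pderiv_mult pderiv_pCons pderiv_1)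
next
  case (Suc m)
  define T where "T = tri [:0, 1:] [:[:0, 1::real:]:]"
  have T: "T (Suc m) c = T m (c - 1) + [:0, 1:] * T m c + [:[:0, 1:]:] * T m (c + 1)" for m c
    by (simp add: T_def)
  have IH: "d_s (T (Suc m) c) = of_nat (Suc m) * T m c" for c
    using Suc by (simp add: T_def)
  have "d_s (T (Suc (Suc m)) c) = d_s (T (Suc m) (c - 1)) + [:0, 1:] * d_s (T (Suc m) c)
      + T (Suc m) c + [:[:0, 1:]:] * d_s (T (Suc m) (c + 1))"
    unfolding T[of "Suc m"] by (simp add: pderiv_add pderiv_mult pderiv_pCons del: mult_pCons_left)
  also have "\<dots> = of_nat (Suc (Suc m)) * T (Suc m) c"
    unfolding IH unfolding T[of m] by (simp add: algebra_simps del: mult_pCons_left mult_pCons_right)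
  finally show ?case by (simp only: T_def)
qed

text \<open>The derivative of \<open>\<ell>\<close> in \<open>r\<close> is \<open>1/h\<close>, and
  this factor moves the index of the coefficient up by one.\<close>

lemma d_r_tri: "d_r (tri [:0, 1:] [:[:0, 1:]:] (Suc m) c)
    = of_nat (Suc m) * tri [:0, 1:] [:[:0, 1:]:] m (c + 1)"
proof (induction m arbitrary: c)
  case 0
  then show ?case
    by (auto simp: d_r_add map_poly_pCons pderiv_pCons one_pCons)
next
  case (Suc m)
  define T where "T = tri [:0, 1:] [:[:0, 1::real:]:]"
  have T: "T (Suc m) c = T m (c - 1) + [:0, 1:] * T m c + [:[:0, 1:]:] * T m (c + 1)" for m c
    by (simp add: T_def)
  have IH: "d_r (T (Suc m) c) = of_nat (Suc m) * T m (c + 1)" for c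
    using Suc by (simp add: T_def)
  have "d_r (T (Suc (Suc m)) c) = d_r (T (Suc m) (c - 1)) + [:0, 1:] * d_r (T (Suc m) c)
      + T (Suc m) (c + 1) + [:[:0, 1:]:] * d_r (T (Suc m) (c + 1))"
    unfolding T[of "Suc m"]
    by (simp add: d_r_add d_r_smult map_poly_pCons pderiv_pCons one_pCons[symmetric])
  also have "\<dots> = of_nat (Suc (Suc m)) * T (Suc m) (c + 1)"
    unfolding IH unfolding T[of m] by (simp add: algebra_simps del: mult_pCons_left mult_pCons_right)
  finally show ?case by (simp only: T_def)
qed

section \<open>Operators applied to trinomial coefficients\<close>

lemma d_s_of_nat_mult: "d_s (of_nat n * p) = of_nat n * d_s p"
  by (simp add: of_nat_poly pderiv_smult)

lemma d_r_of_nat_mult: "d_r (of_nat n * p) = of_nat n * d_r p"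
  by (simp add: of_nat_poly d_r_smult pderiv_pCons)

lemma d_s_dtri: "d_s (dtri [:0, 1:] [:[:0, 1:]:] j m c)
    = of_nat (Suc j) * dtri [:0, 1:] [:[:0, 1:]:] (Suc j) m c"
proof (cases "j < m")
  case True
  then obtain k where k: "m - j = Suc k" "m - Suc j = k"
    by (metis Suc_diff_Suc)
  have "d_s (dtri [:0, 1:] [:[:0, 1:]:] j m c)
      = of_nat ((m choose j) * (m - j)) * tri [:0, 1:] [:[:0, 1:]:] k c"
    unfolding dtri_def k d_s_of_nat_mult d_s_tri by (simp only: of_nat_mult mult.assoc)
  also have "\<dots> = of_nat (Suc j * (m choose Suc j)) * tri [:0, 1:] [:[:0, 1:]:] k c"
    by (simp only: choose_mult_diff)
  finally show ?thesis
    unfolding dtri_def k by (simp only: of_nat_mult mult.assoc)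
next
  case False
  then show ?thesis
    by (auto simp: dtri_def binomial_eq_0 d_s_of_nat_mult pderiv_1)
qed

lemma d_r_dtri: "d_r (dtri [:0, 1:] [:[:0, 1:]:] j m c)
    = of_nat (Suc j) * dtri [:0, 1:] [:[:0, 1:]:] (Suc j) m (c + 1)"
proof (cases "j < m")
  case True
  then obtain k where k: "m - j = Suc k" "m - Suc j = k"
    by (metis Suc_diff_Suc)
  have "d_r (dtri [:0, 1:] [:[:0, 1:]:] j m c)
      = of_nat ((m choose j) * (m - j)) * tri [:0, 1:] [:[:0, 1:]:] k (c + 1)"
    unfolding dtri_def k d_r_of_nat_mult d_r_tri by (simp only: of_nat_mult mult.assoc)
  also have "\<dots> = of_nat (Suc j * (m choose Suc j)) * tri [:0, 1:] [:[:0, 1:]:] k (c + 1)"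
    by (simp only: choose_mult_diff)
  finally show ?thesis
    unfolding dtri_def k by (simp only: of_nat_mult mult.assoc)
next
  case False
  then show ?thesis
    by (auto simp: dtri_def binomial_eq_0 d_r_of_nat_mult one_pCons map_poly_pCons)
qed

lemma funpow_d_r_tri: "(d_r ^^ b) (tri [:0, 1:] [:[:0, 1:]:] m c)
    = of_nat (fact b) * dtri [:0, 1:] [:[:0, 1:]:] b m (c + int b)"
proof (induction b)
  case 0
  then show ?case by (simp add: dtri_0)
next
  case (Suc b)
  have "c + int b + 1 = c + int (Suc b)"
    by simp
  with Suc show ?case
    by (simp only: funpow.simps comp_apply d_r_of_nat_mult d_r_dtri)
      (simp add: algebra_simps)
qed

lemma funpow_d_s_dtri: "(d_s ^^ a) (of_nat (fact b) * dtri [:0, 1:] [:[:0, 1:]:] b m c)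
    = of_nat (fact (a + b)) * dtri [:0, 1:] [:[:0, 1:]:] (a + b) m c"
proof (induction a)
  case 0
  then show ?case by simp
next
  case (Suc a)
  then show ?case
    by (simp only: funpow.simps comp_apply d_s_of_nat_mult d_s_dtri)
      (simp add: algebra_simps)
qed

lemma funpow_d_s_d_r_tri: "(d_s ^^ a) ((d_r ^^ b) (tri [:0, 1:] [:[:0, 1:]:] m 0))
    = of_nat (fact (a + b)) * dtri [:0, 1:] [:[:0, 1:]:] (a + b) m (int b)"
  by (simp only: funpow_d_r_tri funpow_d_s_dtri add_0)

lemma funpow_d_s_sum: "(d_s ^^ a) (\<Sum>i\<in>A. [:[:c i:]:] * f i) = (\<Sum>i\<in>A. [:[:c i:]:] * (d_s ^^ a) (f i))"
proof (induction a)
  case (Suc a)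
  then show ?case
    using higher_pderiv_sum[of 1 "\<lambda>i. [:[:c i:]:] * (d_s ^^ a) (f i)" A] by (simp add: pderiv_smult)
qed simp

lemma d_r_sum: "d_r (sum f A) = (\<Sum>i\<in>A. d_r (f i))"
  by (induction A rule: infinite_finite_induct) (simp_all add: d_r_add)

lemma funpow_d_r_sum: "(d_r ^^ b) (\<Sum>i\<in>A. [:[:c i:]:] * f i) = (\<Sum>i\<in>A. [:[:c i:]:] * (d_r ^^ b) (f i))"
  by (induction b) (simp_all add: d_r_sum d_r_smult pderiv_pCons)

lemma map_poly_fps_const_add:
  "map_poly fps_const (p + q) = map_poly fps_const p + map_poly fps_const (q :: real poly)"
  by (intro poly_eqI) (simp add: coeff_map_poly)

lemma eval_sr_add: "eval_sr (p + q) \<sigma> \<rho> = eval_sr p \<sigma> \<rho> + eval_sr q \<sigma> \<rho>"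
proof -
  have "map_poly (\<lambda>c. poly (map_poly fps_const c) \<rho>) (p + q)
      = map_poly (\<lambda>c. poly (map_poly fps_const c) \<rho>) p + map_poly (\<lambda>c. poly (map_poly fps_const c) \<rho>) q"
    by (intro poly_eqI) (simp add: coeff_map_poly map_poly_fps_const_add)
  then show ?thesis
    by (simp add: eval_sr_def)
qed

lemma eval_sr_0 [simp]: "eval_sr 0 \<sigma> \<rho> = 0"
  by (simp add: eval_sr_def)

lemma eval_sr_sum: "eval_sr (sum f A) \<sigma> \<rho> = (\<Sum>i\<in>A. eval_sr (f i) \<sigma> \<rho>)"
  by (induction A rule: infinite_finite_induct) (simp_all add: eval_sr_add)

lemma eval_sr_pCons: "eval_sr (pCons c p) \<sigma> \<rho> = poly (map_poly fps_const c) \<rho> + \<sigma> * eval_sr p \<sigma> \<rho>"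
  by (simp add: eval_sr_def map_poly_pCons)

lemma eval_sr_const_mult: "eval_sr ([:[:c:]:] * p) \<sigma> \<rho> = fps_const c * eval_sr p \<sigma> \<rho>"
proof (induction p)
  case (pCons a p)
  have "map_poly fps_const (smult c a) = smult (fps_const c) (map_poly fps_const a)"
    by (intro poly_eqI) (simp add: coeff_map_poly)
  with pCons show ?case
    by (simp add: eval_sr_pCons algebra_simps)
qed simp

lemma eval_sr_of_nat_mult: "eval_sr (of_nat n * p) \<sigma> \<rho> = of_nat n * eval_sr p \<sigma> \<rho>"
  by (induction n) (simp_all add: distrib_right eval_sr_add)

lemma eval_sr_r_mult: "eval_sr ([:[:0, 1:]:] * p) \<sigma> \<rho> = \<rho> * eval_sr p \<sigma> \<rho>"
proof (induction p)
  case (pCons a p)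
  have "map_poly fps_const (pCons 0 a) = pCons 0 (map_poly fps_const a)"
    by (simp add: map_poly_pCons)
  with pCons show ?case
    by (simp add: eval_sr_pCons algebra_simps)
qed simp

lemma eval_sr_tri: "eval_sr (tri [:0, 1:] [:[:0, 1:]:] m c) \<sigma> \<rho> = tri \<sigma> \<rho> m c"
proof (induction m arbitrary: c)
  case 0
  then show ?case by (simp add: one_pCons eval_sr_pCons map_poly_pCons)
next
  case (Suc m)
  have "eval_sr ([:0, 1:] * p) \<sigma> \<rho> = \<sigma> * eval_sr p \<sigma> \<rho>" for p
    by (simp add: eval_sr_pCons)
  with Suc show ?case
    by (simp only: tri.simps eval_sr_add eval_sr_r_mult)
qed

lemma eval_sr_dtri: "eval_sr (dtri [:0, 1:] [:[:0, 1:]:] j m c) \<sigma> \<rho> = dtri \<sigma> \<rho> j m c"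
  by (simp add: dtri_def eval_sr_of_nat_mult eval_sr_tri)

text \<open>
  All derivatives of \<open>(h + s + r/h)\<^sup>m\<close> beyond the bounds \<open>m\<close> vanish. Since these bounds do not depend on \<open>P\<close>,
  the sum is additive in \<open>P\<close>.
\<close>

definition op_tri :: "diff_op \<Rightarrow> nat \<Rightarrow> real fps \<Rightarrow> real fps \<Rightarrow> real fps" where
  "op_tri P m \<sigma> \<rho> =
     (\<Sum>b\<le>m. \<Sum>a\<le>m. laurent_eval (coeff (coeff P b) a) \<rho>
                      * (fact (a + b) * dtri \<sigma> \<rho> (a + b) m (int b)))"

lemma laurent_eval_0 [simp]: "laurent_eval 0 \<rho> = 0"
  by (simp add: laurent_eval_def)

lemma sum_atMost_extend:
  fixes f :: "nat \<Rightarrow> 'a::comm_monoid_add"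
  assumes "m \<le> n" "\<And>i. m < i \<Longrightarrow> f i = 0"
  shows "(\<Sum>i\<le>m. f i) = (\<Sum>i\<le>n. f i)"
  using assms by (intro sum.mono_neutral_left) auto

lemma apply_op_tri: "apply_op P (tri [:0, 1:] [:[:0, 1:]:] m 0) \<sigma> \<rho> = op_tri P m \<sigma> \<rho>"
proof -
  define f where "f = (\<lambda>b a. laurent_eval (coeff (coeff P b) a) \<rho>
                      * (fact (a + b) * dtri \<sigma> \<rho> (a + b) m (int b)))"
  \<comment> \<open>The summation bounds in \<open>apply_op\<close> depend on \<open>P\<close>,
    those in \<open>op_tri\<close> on \<open>m\<close>; both double sums are extended by zeros to a
    common bound.\<close>
  obtain N where N: "m \<le> N" "degree P \<le> N" "\<And>b. degree (coeff P b) \<le> N"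
  proof
    let ?N = "m + degree P + (\<Sum>b\<le>degree P. degree (coeff P b))"
    show "degree (coeff P b) \<le> ?N" for b
    proof (cases "b \<le> degree P")
      case True
      then have "degree (coeff P b) \<le> (\<Sum>b\<le>degree P. degree (coeff P b))"
        by (intro member_le_sum) auto
      then show ?thesis by simp
    qed (simp add: coeff_eq_0)
  qed auto
  have f1: "f b a = 0" if "degree P < b \<or> degree (coeff P b) < a" for a b
    using that by (auto simp: f_def coeff_eq_0)
  have f2: "f b a = 0" if "m < b \<or> m < a" for a b
    using that by (auto simp: f_def dtri_eq_0)
  have "apply_op P (tri [:0, 1:] [:[:0, 1:]:] m 0) \<sigma> \<rho> = (\<Sum>b\<le>degree P. \<Sum>a\<le>degree (coeff P b). f b a)"
    unfolding apply_op_def f_def funpow_d_s_d_r_tri eval_sr_of_nat_mult eval_sr_dtri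
    by (simp only: of_nat_fact)
  also have "\<dots> = (\<Sum>b\<le>N. \<Sum>a\<le>N. f b a)"
  proof -
    have "(\<Sum>a\<le>degree (coeff P b). f b a) = (\<Sum>a\<le>N. f b a)" for b
      using N f1 by (intro sum_atMost_extend) auto
    then show ?thesis
      using N f1 by (simp only:) (intro sum_atMost_extend, auto)
  qed
  also have "\<dots> = (\<Sum>b\<le>m. \<Sum>a\<le>m. f b a)"
  proof -
    have "(\<Sum>a\<le>m. f b a) = (\<Sum>a\<le>N. f b a)" for b
      using N f2 by (intro sum_atMost_extend) auto
    then have "(\<Sum>b\<le>m. \<Sum>a\<le>m. f b a) = (\<Sum>b\<le>N. \<Sum>a\<le>N. f b a)"
      using N f2 by (simp only:) (intro sum_atMost_extend, auto)
    then show ?thesis ..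
  qed
  finally show ?thesis
    by (simp add: op_tri_def f_def)
qed

lemma apply_op_central_coeff:
  "apply_op P (central_coeff W) \<sigma> \<rho> = (\<Sum>m\<le>degree W. fps_const (coeff W m) * op_tri P m \<sigma> \<rho>)"
proof -
  let ?t = "\<lambda>m. tri [:0, 1:] [:[:0, 1:]:] m 0"
  have swap: "(\<Sum>b\<le>B. \<Sum>a\<le>A b. \<Sum>m\<le>M. f b a m) = (\<Sum>m\<le>M. \<Sum>b\<le>B. \<Sum>a\<le>A b. f b a m)"
    for B M :: nat and A :: "nat \<Rightarrow> nat" and f :: "nat \<Rightarrow> nat \<Rightarrow> nat \<Rightarrow> real fps"
  proof -
    have "(\<Sum>b\<le>B. \<Sum>a\<le>A b. \<Sum>m\<le>M. f b a m) = (\<Sum>b\<le>B. \<Sum>m\<le>M. \<Sum>a\<le>A b. f b a m)"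
      by (intro sum.cong refl sum.swap)
    also have "\<dots> = (\<Sum>m\<le>M. \<Sum>b\<le>B. \<Sum>a\<le>A b. f b a m)"
      by (rule sum.swap)
    finally show ?thesis .
  qed
  have "apply_op P (central_coeff W) \<sigma> \<rho>
      = (\<Sum>b\<le>degree P. \<Sum>a\<le>degree (coeff P b). \<Sum>m\<le>degree W.
           fps_const (coeff W m) * (laurent_eval (coeff (coeff P b) a) \<rho>
             * eval_sr ((d_s ^^ a) ((d_r ^^ b) (?t m))) \<sigma> \<rho>))"
    unfolding apply_op_def central_coeff_conv_tri funpow_d_r_sum funpow_d_s_sum eval_sr_sum
      eval_sr_const_mult sum_distrib_left by (simp only: mult.left_commute)
  also have "\<dots> = (\<Sum>m\<le>degree W. fps_const (coeff W m) * apply_op P (?t m) \<sigma> \<rho>)"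
    unfolding apply_op_def sum_distrib_left by (rule swap)
  finally show ?thesis
    by (simp only: apply_op_tri)
qed

lemma laurent_eval_superset:
  assumes "finite A" "Poly_Mapping.keys c \<subseteq> A"
  shows "laurent_eval c \<rho> = (\<Sum>k\<in>A. fps_const (of_rat (Poly_Mapping.lookup c k)) * \<rho> powi k)"
  unfolding laurent_eval_def using assms
  by (intro sum.mono_neutral_left) (auto simp: in_keys_iff)

lemma laurent_eval_add: "laurent_eval (c + d) \<rho> = laurent_eval c \<rho> + laurent_eval d \<rho>"
proof -
  let ?A = "Poly_Mapping.keys c \<union> Poly_Mapping.keys d"
  have "Poly_Mapping.keys (c + d) \<subseteq> ?A"
    by (rule keys_add)
  then show ?thesis
    using laurent_eval_superset[of ?A c] laurent_eval_superset[of ?A d]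
      laurent_eval_superset[of ?A "c + d"]
    by (simp add: lookup_add of_rat_add sum.distrib[symmetric] distrib_right flip: fps_const_add)
qed

lemma laurent_eval_single: "laurent_eval (Poly_Mapping.single k q) \<rho> = fps_const (of_rat q) * \<rho> powi k"
  by (simp add: laurent_eval_def)

text \<open>Power series do not form a field, so the law of exponents requires \<open>\<rho>\<close>
  to be a unit, that is, to have a nonzero constant term. For the series of \<open>r\<close> this is
  provided by \<open>admissible\<close>.\<close>

lemma fps_powi_add:
  fixes \<rho> :: "real fps"
  assumes "fps_nth \<rho> 0 \<noteq> 0"
  shows "\<rho> powi (k + l) = \<rho> powi k * \<rho> powi l"
proof -
  have inv: "inverse \<rho> * \<rho> = 1"
    using assms by (rule inverse_mult_eq_1)
  have 1: "\<rho> powi (k + 1) = \<rho> powi k * \<rho>" for k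
  proof (cases "k \<ge> 0")
    case True
    then show ?thesis
      by (simp add: power_int_def nat_add_distrib)
  next
    case False
    then obtain n where n: "k = - int (Suc n)"
      by (metis int_cases not_le of_nat_0_le_iff negD linorder_not_le)
    then have "\<rho> powi (k + 1) = inverse \<rho> ^ n"
      by (simp add: power_int_def nat_minus_as_int)
    moreover have "\<rho> powi k = inverse \<rho> ^ Suc n"
      using n by (simp add: power_int_def nat_add_distrib)
    ultimately show ?thesis
      by (simp add: mult.assoc mult.left_commute[of "inverse \<rho>"] inv)
  qed
  have nat: "\<rho> powi (k + int n) = \<rho> powi k * \<rho> ^ n" for k n
    by (induction n) (simp_all add: 1 mult.assoc mult.commute add.assoc[symmetric] add.commute[of 1])
  show ?thesis
  proof (cases "l \<ge> 0")
    case True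
    then obtain n where "l = int n"
      using nonneg_int_cases by blast
    then show ?thesis
      by (simp add: nat)
  next
    case False
    then obtain n where n: "l = - int n"
      by (metis int_cases2 of_nat_0_le_iff)
    have "\<rho> powi k * inverse \<rho> ^ n = \<rho> powi (k + l) * (inverse \<rho> * \<rho>) ^ n"
      using nat[of "k + l" n] n by (simp add: power_mult_distrib algebra_simps)
    moreover have "\<rho> powi l = inverse \<rho> ^ n"
      using n by (cases n) (simp_all add: power_int_def nat_add_distrib)
    ultimately show ?thesis
      by (simp add: inv)
  qed
qed

lemma laurent_eval_single_mult:
  assumes "fps_nth \<rho> 0 \<noteq> 0"
  shows "laurent_eval (Poly_Mapping.single k q * c) \<rho>
         = fps_const (of_rat q) * \<rho> powi k * laurent_eval c \<rho>"
proof (induction c rule: update_induct)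
  case const
  then show ?case by simp
next
  case (update f a b)
  have "Poly_Mapping.update a b f = f + Poly_Mapping.single a b"
    using update by (intro poly_mapping_eqI)
      (auto simp: lookup_update lookup_add lookup_single in_keys_iff when_def)
  with update show ?case
    by (simp add: distrib_left laurent_eval_add mult_single laurent_eval_single of_rat_mult
        fps_powi_add[OF assms] flip: fps_const_mult)
qed

lemma op_tri_add: "op_tri (P + Q) m \<sigma> \<rho> = op_tri P m \<sigma> \<rho> + op_tri Q m \<sigma> \<rho>"
  by (simp add: op_tri_def laurent_eval_add distrib_right sum.distrib)

lemma op_tri_0 [simp]: "op_tri 0 m \<sigma> \<rho> = 0"
  by (simp add: op_tri_def)

lemma op_tri_smult:
  assumes "fps_nth \<rho> 0 \<noteq> 0"
  shows "op_tri (smult [:Poly_Mapping.single k q:] P) m \<sigma> \<rho>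
         = fps_const (of_rat q) * \<rho> powi k * op_tri P m \<sigma> \<rho>"
  by (simp add: op_tri_def laurent_eval_single_mult[OF assms] sum_distrib_left mult.assoc)

lemma op_tri_monom:
  "op_tri (monom (monom (Poly_Mapping.single 0 q) a) b) m \<sigma> \<rho>
   = fps_const (of_rat q) * (fact (a + b) * dtri \<sigma> \<rho> (a + b) m (int b))"
proof (cases "a \<le> m \<and> b \<le> m")
  case True
  have "op_tri (monom (monom (Poly_Mapping.single 0 q) a) b) m \<sigma> \<rho>
    = (\<Sum>b'\<le>m. \<Sum>a'\<le>m. if b' = b \<and> a' = a then
         fps_const (of_rat q) * (fact (a + b) * dtri \<sigma> \<rho> (a + b) m (int b)) else 0)"
    unfolding op_tri_def
    by (intro sum.cong refl) (auto simp: laurent_eval_single)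
  also have "\<dots> = (\<Sum>b'\<le>m. if b' = b then
         fps_const (of_rat q) * (fact (a + b) * dtri \<sigma> \<rho> (a + b) m (int b)) else 0)"
    using True by (intro sum.cong refl) auto
  finally show ?thesis
    using True by simp
next
  case False
  then have "op_tri (monom (monom (Poly_Mapping.single 0 q) a) b) m \<sigma> \<rho> = 0"
    unfolding op_tri_def by (intro sum.neutral ballI) auto
  with False show ?thesis
    by (auto simp: dtri_eq_0)
qed

lemma of_rat_inverse_fact: "(of_rat (1 / fact i) :: real) = 1 / fact i"
  by (metis of_nat_fact of_rat_1 of_rat_divide of_rat_of_nat_eq)

text \<open>The operator \<open>1/j! \<partial>\<^sub>s^(j-c) \<partial>\<^sub>r^c\<close> acts as
  \<open>h^(-c)/j! (d/d\<ell>)^j\<close>, so order \<open>j\<close> reaches the indices from 0 to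
  \<open>j\<close>.\<close>

lemma op_tri_monom_inverse_fact:
  assumes "c \<le> j"
  shows "op_tri (monom (monom (Poly_Mapping.single 0 (1 / fact j)) (j - c)) c) m \<sigma> \<rho> = dtri \<sigma> \<rho> j m (int c)"
proof -
  have "(fact j :: real fps) = fps_const (fact j)"
    by (metis fps_of_nat of_nat_fact)
  then show ?thesis
    using assms by (simp add: op_tri_monom of_rat_inverse_fact mult.assoc[symmetric])
qed

section \<open>Paths with marked steps\<close>

text \<open>
  In \<open>\<Sum>\<^sub>j k\<^sup>j/j! \<partial>\<^sub>n\<^sup>j s\<close> and \<open>\<Sum>\<^sub>j k\<^sup>j/j! \<partial>\<^sub>n\<^sup>j r\<close> the height \<open>k\<close> acts as \<open>D = h d/dh\<close>. The mark \<open>(True, j)\<close> stands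
  for the term \<open>j\<close> of \<open>s\<close>, which acts by \<open>D\<^sup>j/j!\<close>, and \<open>(False, j)\<close> for the term \<open>j\<close> of \<open>r\<close>, which acts
  by \<open>h\<^sup>-\<^sup>1 D\<^sup>j/j!\<close>.
\<close>

type_synonym mark = "bool \<times> nat"

definition mark_op :: "mark \<Rightarrow> (int \<Rightarrow> real fps) \<Rightarrow> int \<Rightarrow> real fps" where
  "mark_op \<mu> f c = (let k = (if fst \<mu> then c else c + 1) in
     fps_const (of_int k ^ snd \<mu> / fact (snd \<mu>)) * f k)"

text \<open>\<open>marked_paths ms m\<close> sums over the paths of \<open>m\<close> steps whose marked steps are \<open>ms\<close>, the last one first.\<close>

fun marked_paths :: "mark list \<Rightarrow> nat \<Rightarrow> real fps \<Rightarrow> real fps \<Rightarrow> int \<Rightarrow> real fps" where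
  "marked_paths [] m \<sigma> \<rho> = tri \<sigma> \<rho> m"
| "marked_paths (\<mu> # ms) 0 \<sigma> \<rho> = (\<lambda>c. 0)"
| "marked_paths (\<mu> # ms) (Suc m) \<sigma> \<rho> = (\<lambda>c. marked_paths (\<mu> # ms) m \<sigma> \<rho> (c - 1)
     + \<sigma> * marked_paths (\<mu> # ms) m \<sigma> \<rho> c + \<rho> * marked_paths (\<mu> # ms) m \<sigma> \<rho> (c + 1)
     + mark_op \<mu> (marked_paths ms m \<sigma> \<rho>) c)"

text \<open>
  Linear combinations of \<open>r\<^sup>b h\<^sup>e\<close> times derivatives of order \<open>j\<close> in \<open>\<ell>\<close>, with \<open>-j \<le> e \<le> j - \<kappa>\<close>. The bounds on
  \<open>e\<close> are what makes \<open>h\<^sup>e (d/d\<ell>)\<^sup>j\<close> a polynomial in \<open>\<partial>\<^sub>s\<close>, \<open>\<partial>\<^sub>r\<close>, since \<open>\<partial>\<^sub>r\<close> acts as \<open>h\<^sup>-\<^sup>1 d/d\<ell>\<close>.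
\<close>

inductive_set resolvent_span :: "int \<Rightarrow> (nat \<Rightarrow> real fps \<Rightarrow> real fps \<Rightarrow> int \<Rightarrow> real fps) set" for \<kappa> where
  zero: "(\<lambda>m \<sigma> \<rho> c. 0) \<in> resolvent_span \<kappa>"
| add_term: "g \<in> resolvent_span \<kappa> \<Longrightarrow> - int j \<le> e \<Longrightarrow> e \<le> int j - \<kappa> \<Longrightarrow>
    (\<lambda>m \<sigma> \<rho> c. fps_const (of_rat q) * \<rho> ^ b * dtri \<sigma> \<rho> j m (c - e) + g m \<sigma> \<rho> c) \<in> resolvent_span \<kappa>"

lemma resolvent_span_mono: "g \<in> resolvent_span \<kappa> \<Longrightarrow> \<kappa>' \<le> \<kappa> \<Longrightarrow> g \<in> resolvent_span \<kappa>'"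
  by (induction rule: resolvent_span.induct) (auto intro!: resolvent_span.intros)

text \<open>\<open>D (h^e f) = e h^e f + h^e D f\<close>, and \<open>dtri_index\<close> writes
  \<open>D f\<close> with order \<open>Suc j\<close> and exponents shifted by one in either
  direction. The order grows along with the exponent, so the bounds on \<open>e\<close>
  persist.\<close>

lemma resolvent_span_index_mult:
  "g \<in> resolvent_span \<kappa> \<Longrightarrow> (\<lambda>m \<sigma> \<rho> c. of_int c * g m \<sigma> \<rho> c) \<in> resolvent_span \<kappa>"
proof (induction rule: resolvent_span.induct)
  case zero
  then show ?case by (simp add: resolvent_span.zero)
next
  case (add_term g j e q b)
  let ?t = "\<lambda>q b j e m \<sigma> \<rho> c. fps_const (of_rat q) * \<rho> ^ b * dtri \<sigma> \<rho> j m (c - e)"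
  have "(\<lambda>m \<sigma> \<rho> c. ?t (q * of_int e) b j e m \<sigma> \<rho> c + (?t (q * of_nat (Suc j)) b (Suc j) (e + 1) m \<sigma> \<rho> c
     + (?t (- q * of_nat (Suc j)) (Suc b) (Suc j) (e - 1) m \<sigma> \<rho> c + of_int c * g m \<sigma> \<rho> c)))
     \<in> resolvent_span \<kappa>" (is "?f \<in> _")
    using add_term by (intro resolvent_span.add_term) auto
  also have "?f = (\<lambda>m \<sigma> \<rho> c. of_int c * (?t q b j e m \<sigma> \<rho> c + g m \<sigma> \<rho> c))"
  proof (intro ext)
    fix m c and \<sigma> \<rho> :: "real fps"
    have i: "(of_int c :: real fps) = of_int e + of_int (c - e)"
      by simp
    have r: "fps_const (of_rat (q * of_int e)) = fps_const (of_rat q) * (of_int e :: real fps)"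
      "fps_const (of_rat (q * of_nat (Suc j))) = fps_const (of_rat q) * (of_nat (Suc j) :: real fps)"
      "fps_const (of_rat (- q * of_nat (Suc j))) = - (fps_const (of_rat q) * (of_nat (Suc j) :: real fps))"
      by (simp_all add: of_rat_mult of_rat_minus fps_of_int[symmetric] fps_of_nat[symmetric]
          del: of_nat_Suc flip: fps_const_mult fps_const_neg)
    have "of_int c * ?t q b j e m \<sigma> \<rho> c = of_int e * ?t q b j e m \<sigma> \<rho> c
        + fps_const (of_rat q) * \<rho> ^ b * (of_int (c - e) * dtri \<sigma> \<rho> j m (c - e))"
      unfolding i by (simp add: algebra_simps)
    also have "\<dots> = ?t (q * of_int e) b j e m \<sigma> \<rho> c + ?t (q * of_nat (Suc j)) b (Suc j) (e + 1) m \<sigma> \<rho> c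
     + ?t (- q * of_nat (Suc j)) (Suc b) (Suc j) (e - 1) m \<sigma> \<rho> c"
      by (simp only: dtri_index r) (simp add: algebra_simps del: fps_const_neg)
    finally show "?f m \<sigma> \<rho> c = of_int c * (?t q b j e m \<sigma> \<rho> c + g m \<sigma> \<rho> c)"
      by (simp only: distrib_left add.assoc)
  qed
  finally show ?case .
qed

lemma resolvent_span_power_mult:
  "g \<in> resolvent_span \<kappa> \<Longrightarrow> (\<lambda>m \<sigma> \<rho> c. of_int c ^ k * g m \<sigma> \<rho> c) \<in> resolvent_span \<kappa>"
proof (induction k)
  case (Suc k)
  then show ?case
    using resolvent_span_index_mult[of "\<lambda>m \<sigma> \<rho> c. of_int c ^ k * g m \<sigma> \<rho> c"]
    by (simp add: mult.assoc)
qed simp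

lemma resolvent_span_const_mult:
  "g \<in> resolvent_span \<kappa> \<Longrightarrow> (\<lambda>m \<sigma> \<rho> c. fps_const (of_rat a) * g m \<sigma> \<rho> c) \<in> resolvent_span \<kappa>"
proof (induction rule: resolvent_span.induct)
  case zero
  then show ?case by (simp add: resolvent_span.zero)
next
  case (add_term g j e q b)
  have "(\<lambda>m \<sigma> \<rho> c. fps_const (of_rat (a * q)) * \<rho> ^ b * dtri \<sigma> \<rho> j m (c - e)
      + fps_const (of_rat a) * g m \<sigma> \<rho> c) \<in> resolvent_span \<kappa>"
    using add_term by (intro resolvent_span.add_term) auto
  then show ?case
    by (simp add: distrib_left mult.assoc of_rat_mult flip: fps_const_mult)
qed

text \<open>A further unmarked segment raises the power of the resolvent.\<close>

lemma resolvent_span_convolution: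
  assumes "g \<in> resolvent_span 0" "\<delta> = 0 \<or> \<delta> = 1"
  shows "\<exists>f\<in>resolvent_span 1. \<forall>m \<sigma> \<rho> c. f 0 \<sigma> \<rho> c = 0 \<and>
    f (Suc m) \<sigma> \<rho> c = f m \<sigma> \<rho> (c - 1) + \<sigma> * f m \<sigma> \<rho> c + \<rho> * f m \<sigma> \<rho> (c + 1) + g m \<sigma> \<rho> (c + \<delta>)"
  using assms(1)
proof (induction rule: resolvent_span.induct)
  case zero
  show ?case
    by (intro bexI[of _ "\<lambda>m \<sigma> \<rho> c. 0"] resolvent_span.zero) simp
next
  case (add_term g j e q b)
  then obtain f where f: "f \<in> resolvent_span 1" "\<And>\<sigma> \<rho> c. f 0 \<sigma> \<rho> c = 0"
    "\<And>m \<sigma> \<rho> c. f (Suc m) \<sigma> \<rho> c = f m \<sigma> \<rho> (c - 1) + \<sigma> * f m \<sigma> \<rho> c + \<rho> * f m \<sigma> \<rho> (c + 1) + g m \<sigma> \<rho> (c + \<delta>)"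
    by blast
  \<comment> \<open>The order goes up by one while \<open>e\<close> moves down by at most one. Hence
    \<open>e - \<delta> \<le> Suc j - 1\<close>, which improves the parameter from 0 to 1.\<close>
  let ?f = "\<lambda>m \<sigma> \<rho> c. fps_const (of_rat q) * \<rho> ^ b * dtri \<sigma> \<rho> (Suc j) m (c - (e - \<delta>)) + f m \<sigma> \<rho> c"
  have "?f \<in> resolvent_span 1"
    using add_term assms(2) f(1) by (intro resolvent_span.add_term) auto
  moreover have "?f 0 \<sigma> \<rho> c = 0" for \<sigma> \<rho> c
    by (simp add: f dtri_eq_0)
  moreover have "?f (Suc m) \<sigma> \<rho> c = ?f m \<sigma> \<rho> (c - 1) + \<sigma> * ?f m \<sigma> \<rho> c + \<rho> * ?f m \<sigma> \<rho> (c + 1)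
      + (fps_const (of_rat q) * \<rho> ^ b * dtri \<sigma> \<rho> j m (c + \<delta> - e) + g m \<sigma> \<rho> (c + \<delta>))" for m \<sigma> \<rho> c
    unfolding f(3) dtri_Suc_Suc by (simp add: algebra_simps)
  ultimately show ?case
    by (intro bexI[of _ ?f]) auto
qed

text \<open>\<open>mark_op\<close> multiplies by a power of the index and then shifts by
  \<open>\<delta>\<close>, so one more mark leads to the recursion solved by
  \<open>resolvent_span_convolution\<close>. The gain to \<open>resolvent_span 1\<close> is needed
  for the entry below the diagonal.\<close>

lemma marked_paths_Cons_in_resolvent_span:
  assumes "marked_paths ms \<in> resolvent_span 0"
  shows "marked_paths (\<mu> # ms) \<in> resolvent_span 1"
proof -
  define \<delta> :: int where "\<delta> = (if fst \<mu> then 0 else 1)"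
  let ?g = "\<lambda>m \<sigma> \<rho> c. fps_const (of_rat (1 / fact (snd \<mu>))) * (of_int c ^ snd \<mu> * marked_paths ms m \<sigma> \<rho> c)"
  have g: "?g \<in> resolvent_span 0"
    using assms by (intro resolvent_span_const_mult resolvent_span_power_mult)
  have op: "mark_op \<mu> (marked_paths ms m \<sigma> \<rho>) c = ?g m \<sigma> \<rho> (c + \<delta>)" for m \<sigma> \<rho> c
  proof -
    have "(of_int k :: real fps) ^ i = fps_const (of_int k ^ i)" for k i
      by (simp flip: fps_of_int add: fps_const_power)
    then have "?g m \<sigma> \<rho> k = fps_const (of_int k ^ snd \<mu> / fact (snd \<mu>)) * marked_paths ms m \<sigma> \<rho> k" for k
      by (simp only: mult.assoc[symmetric] fps_const_mult of_rat_inverse_fact) simp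
    then show ?thesis
      by (simp only: mark_op_def Let_def \<delta>_def) simp
  qed
  have "\<delta> = 0 \<or> \<delta> = 1"
    by (simp add: \<delta>_def)
  from resolvent_span_convolution[OF g this]
  obtain f where f: "f \<in> resolvent_span 1" "\<And>\<sigma> \<rho> c. f 0 \<sigma> \<rho> c = 0"
    "\<And>m \<sigma> \<rho> c. f (Suc m) \<sigma> \<rho> c = f m \<sigma> \<rho> (c - 1) + \<sigma> * f m \<sigma> \<rho> c + \<rho> * f m \<sigma> \<rho> (c + 1)
       + ?g m \<sigma> \<rho> (c + \<delta>)"
    by blast
  have "marked_paths (\<mu> # ms) m \<sigma> \<rho> c = f m \<sigma> \<rho> c" for m \<sigma> \<rho> c
    by (induction m arbitrary: c) (simp_all add: f(2) f(3) op)
  then have "marked_paths (\<mu> # ms) = f"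
    by (intro ext)
  with f show ?thesis
    by simp
qed

lemma marked_paths_in_resolvent_span: "marked_paths ms \<in> resolvent_span 0"
proof (induction ms)
  case Nil
  have "(\<lambda>m \<sigma> \<rho> c. fps_const (of_rat 1) * \<rho> ^ 0 * dtri \<sigma> \<rho> 0 m (c - 0) + 0) \<in> resolvent_span 0"
    by (intro resolvent_span.intros) auto
  moreover have "marked_paths [] = (\<lambda>m \<sigma> \<rho> c. tri \<sigma> \<rho> m c)"
    by (intro ext) simp
  ultimately show ?case
    by (simp add: dtri_0)
next
  case (Cons \<mu> ms)
  then show ?case
    using resolvent_span_mono[OF marked_paths_Cons_in_resolvent_span[OF Cons.IH]] by simp
qed

text \<open>The operators are constructed twice, once with polynomial coefficients and once with
  degree at most one in \<open>\<partial>\<^sub>r\<close>. The locale collects what the construction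
  needs: closure under sums and under rational multiples of nonnegative powers of \<open>r\<close>,
  and a realisation of each derivative at the indices from 0 to its order.\<close>

locale operator_class =
  fixes S :: "diff_op set"
  assumes zero_closed: "0 \<in> S"
    and add_closed: "P \<in> S \<Longrightarrow> Q \<in> S \<Longrightarrow> P + Q \<in> S"
    and smult_closed: "P \<in> S \<Longrightarrow> smult [:Poly_Mapping.single (int b) q:] P \<in> S"
    and represents_dtri: "c \<le> j \<Longrightarrow>
      \<exists>P\<in>S. \<forall>m \<sigma> \<rho>. fps_nth \<rho> 0 \<noteq> 0 \<longrightarrow> op_tri P m \<sigma> \<rho> = dtri \<sigma> \<rho> j m (int c)"
begin

definition represents :: "diff_op \<Rightarrow> (nat \<Rightarrow> real fps \<Rightarrow> real fps \<Rightarrow> real fps) \<Rightarrow> bool" where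
  "represents P g \<longleftrightarrow> P \<in> S \<and> (\<forall>m \<sigma> \<rho>. fps_nth \<rho> 0 \<noteq> 0 \<longrightarrow> op_tri P m \<sigma> \<rho> = g m \<sigma> \<rho>)"

lemma represents_add:
  "represents P f \<Longrightarrow> represents Q g \<Longrightarrow> represents (P + Q) (\<lambda>m \<sigma> \<rho>. f m \<sigma> \<rho> + g m \<sigma> \<rho>)"
  by (simp add: represents_def add_closed op_tri_add)

text \<open>Negative indices are reflected to positive ones by \<open>dtri_minus\<close>, at the
  cost of a nonnegative power of \<open>r\<close>.\<close>

lemma represents_dtri_int:
  assumes "\<bar>c\<bar> \<le> int j"
  shows "\<exists>P. represents P (\<lambda>m \<sigma> \<rho>. fps_const (of_rat q) * \<rho> ^ b * dtri \<sigma> \<rho> j m c)"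
proof -
  define n where "n = nat \<bar>c\<bar>"
  define b' where "b' = (if c < 0 then b + n else b)"
  from assms have "n \<le> j"
    by (simp add: n_def)
  then obtain P where P: "P \<in> S"
    "\<And>m \<sigma> \<rho>. fps_nth \<rho> 0 \<noteq> 0 \<Longrightarrow> op_tri P m \<sigma> \<rho> = dtri \<sigma> \<rho> j m (int n)"
    using represents_dtri by blast
  have "\<rho> ^ b * dtri \<sigma> \<rho> j m c = \<rho> ^ b' * dtri \<sigma> \<rho> j m (int n)" for m and \<sigma> \<rho> :: "real fps"
    using dtri_minus[of \<sigma> \<rho> j m n] by (auto simp: b'_def n_def power_add)
  then have "represents (smult [:Poly_Mapping.single (int b') q:] P)
      (\<lambda>m \<sigma> \<rho>. fps_const (of_rat q) * \<rho> ^ b * dtri \<sigma> \<rho> j m c)"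
    using P by (simp add: represents_def smult_closed op_tri_smult mult.assoc)
  then show ?thesis ..
qed

text \<open>The index \<open>- \<kappa>\<close> is 0 for the diagonal entry and -1 for the one
  below. The bounds on \<open>e\<close> place \<open>- \<kappa> - e\<close> between
  \<open>- j\<close> and \<open>j\<close>.\<close>

lemma represents_resolvent_span:
  assumes "g \<in> resolvent_span \<kappa>" "\<kappa> \<ge> 0"
  shows "\<exists>P. represents P (\<lambda>m \<sigma> \<rho>. g m \<sigma> \<rho> (- \<kappa>))"
  using assms(1)
proof (induction rule: resolvent_span.induct)
  case zero
  then show ?case
    by (intro exI[of _ 0]) (simp add: represents_def zero_closed)
next
  case (add_term g j e q b)
  then have "\<bar>- \<kappa> - e\<bar> \<le> int j"
    using assms(2) by auto
  with add_term.IH represents_dtri_int represents_add show ?case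
    by blast
qed

lemma represents_sum:
  assumes "finite A" "\<And>a. a \<in> A \<Longrightarrow> \<exists>P. represents P (g a)"
  shows "\<exists>P. represents P (\<lambda>m \<sigma> \<rho>. \<Sum>a\<in>A. g a m \<sigma> \<rho>)"
  using assms
proof (induction A)
  case empty
  show ?case
    by (intro exI[of _ 0]) (simp add: represents_def zero_closed)
next
  case (insert a A)
  then show ?case
    using represents_add[of _ "g a" _ "\<lambda>m \<sigma> \<rho>. \<Sum>a\<in>A. g a m \<sigma> \<rho>"] by simp blast
qed

end

section \<open>The continuum string equations\<close>

text \<open>Congruence modulo \<open>fps_X ^ Suc K\<close>, by which infinite expansions in
  \<open>1/N\<close> are compared through finite sums.\<close>

definition agree :: "nat \<Rightarrow> 'a fps \<Rightarrow> 'a fps \<Rightarrow> bool" where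
  "agree K f g \<longleftrightarrow> (\<forall>i\<le>K. fps_nth f i = fps_nth g i)"

lemma agree_refl [simp]: "agree K f f"
  by (simp add: agree_def)

lemma agree_sym: "agree K f g \<Longrightarrow> agree K g f"
  by (simp add: agree_def)

lemma agree_trans [trans]: "agree K f g \<Longrightarrow> agree K g h \<Longrightarrow> agree K f h"
  by (simp add: agree_def)

lemma agree_add: "agree K f f' \<Longrightarrow> agree K g g' \<Longrightarrow> agree K (f + g) (f' + g')"
  by (simp add: agree_def)

lemma agree_mult: "agree K f f' \<Longrightarrow> agree K g g' \<Longrightarrow> agree K (f * g) (f' * g')"
  unfolding agree_def fps_mult_nth by (intro allI impI sum.cong) auto

lemma agree_sum: "(\<And>a. a \<in> A \<Longrightarrow> agree K (f a) (g a)) \<Longrightarrow> agree K (sum f A) (sum g A)"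
  by (simp add: agree_def fps_sum_nth)

lemma agree_0_if_dvd:
  fixes f :: "'a::comm_ring_1 fps"
  assumes "fps_X ^ n dvd f" "K < n"
  shows "agree K f 0"
  using assms by (auto simp: agree_def fps_X_power_mult_nth elim!: dvdE)

lemma sum_agree_mono_neutral:
  fixes f :: "'a \<Rightarrow> 'b::comm_ring_1 fps"
  assumes "finite B" "A \<subseteq> B" "\<And>b. b \<in> B - A \<Longrightarrow> agree K (f b) 0"
  shows "agree K (sum f B) (sum f A)"
proof -
  have "agree K (sum f (B - A)) (sum (\<lambda>_. 0) (B - A))"
    using assms by (intro agree_sum)
  then have "agree K (sum f A + sum f (B - A)) (sum f A + sum (\<lambda>_. 0) (B - A))"
    by (intro agree_add) simp_all
  then show ?thesis
    using sum.subset_diff[OF assms(2,1), of f] by (simp add: add.commute)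
qed

lemma has_sum_fpsI:
  fixes f :: "'a \<Rightarrow> real fps"
  assumes "\<And>K. \<exists>F. finite F \<and> F \<subseteq> A \<and> agree K (sum f F) l \<and> (\<forall>a\<in>A - F. agree K (f a) 0)"
  shows "(f has_sum l) A"
  unfolding has_sum_def
proof (rule tendsto_fpsI)
  fix K
  obtain F where F: "finite F" "F \<subseteq> A" "agree K (sum f F) l" "\<And>a. a \<in> A - F \<Longrightarrow> agree K (f a) 0"
    using assms[of K] by auto
  have "fps_nth (sum f G) K = fps_nth l K" if "finite G" "F \<subseteq> G" "G \<subseteq> A" for G
  proof -
    have "agree K (sum f G) (sum f F)"
      using that(1,2) by (rule sum_agree_mono_neutral) (use that(3) F(4) in blast)
    then show ?thesis
      using F(3) by (simp add: agree_def)
  qed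
  then show "\<forall>\<^sub>F G in finite_subsets_at_top A. fps_nth (sum f G) K = fps_nth l K"
    unfolding eventually_finite_subsets_at_top using F(1,2) by (intro exI[of _ F]) blast
qed

lemma dn_dvd: "fps_X ^ m dvd dn m f x"
  by (simp add: dn_def)

text \<open>The \<open>m\<close>-th term of the exponential is divisible by
  \<open>fps_X ^ m\<close>, so the series converges coefficientwise and orders up to
  \<open>K\<close> see only \<open>m \<le> K\<close>.\<close>

lemma agree_index_shift:
  "agree K (index_shift k f x) (\<Sum>m\<le>K. fps_const (of_int k ^ m / fact m) * dn m f x)"
proof -
  let ?a = "\<lambda>m. fps_const (of_int k ^ m / fact m) * dn m f x"
  have zero: "fps_nth (?a m) i = 0" if "i < m" for i m
    using that by (simp add: dn_def fps_X_power_mult_nth)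
  have ext: "(\<Sum>m<n. fps_nth (?a m) i) = (\<Sum>m\<le>i. fps_nth (?a m) i)" if "i < n" for i n
    using that zero by (intro sum.mono_neutral_right) auto
  define g where "g = Abs_fps (\<lambda>i. \<Sum>m\<le>i. fps_nth (?a m) i)"
  have "?a sums g"
    unfolding sums_def
  proof (rule tendsto_fpsI)
    fix i
    show "\<forall>\<^sub>F n in sequentially. fps_nth (sum ?a {..<n}) i = fps_nth g i"
      using eventually_gt_at_top[of i]
    proof eventually_elim
      case (elim n)
      then show ?case
        unfolding fps_sum_nth g_def fps_nth_Abs_fps by (rule ext)
    qed
  qed
  then have "index_shift k f x = g"
    unfolding index_shift_def by (simp add: sums_iff)
  moreover have "fps_nth g i = fps_nth (sum ?a {..K}) i" if "i \<le> K" for i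
    using ext[of i "Suc K"] that by (simp add: g_def fps_sum_nth lessThan_Suc_atMost)
  ultimately show ?thesis
    by (simp add: agree_def)
qed

text \<open>Rows of powers of a Jacobi matrix without boundary, by multiplication from the right.\<close>

primrec jacobi_row :: "(int \<Rightarrow> 'a::comm_ring_1) \<Rightarrow> (int \<Rightarrow> 'a) \<Rightarrow> int \<Rightarrow> nat \<Rightarrow> int \<Rightarrow> 'a" where
  "jacobi_row s r k 0 = (\<lambda>c. if c = k then 1 else 0)"
| "jacobi_row s r k (Suc m) = (\<lambda>c. jacobi_row s r k m (c - 1) + s c * jacobi_row s r k m c
     + r (c + 1) * jacobi_row s r k m (c + 1))"

text \<open>This is \<open>L * L^m = L^m * L\<close>. Powers are defined by multiplication from the
  left, whereas appending steps at the right gives each step its weight at the current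
  height.\<close>

lemma jacobi_row_Suc_left:
  "jacobi_row s r k (Suc m) c
   = s k * jacobi_row s r k m c + jacobi_row s r (k + 1) m c + r k * jacobi_row s r (k - 1) m c"
proof (induction m arbitrary: c)
  case 0
  show ?case by auto
next
  case (Suc m)
  let ?J = "jacobi_row s r"
  have "?J k (Suc (Suc m)) c = ?J k (Suc m) (c - 1) + s c * ?J k (Suc m) c + r (c + 1) * ?J k (Suc m) (c + 1)"
    by (rule jacobi_row.simps(2)[THEN fun_cong])
  also have "\<dots> = s k * (?J k m (c - 1) + s c * ?J k m c + r (c + 1) * ?J k m (c + 1))
      + (?J (k + 1) m (c - 1) + s c * ?J (k + 1) m c + r (c + 1) * ?J (k + 1) m (c + 1))
      + r k * (?J (k - 1) m (c - 1) + s c * ?J (k - 1) m c + r (c + 1) * ?J (k - 1) m (c + 1))"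
    unfolding Suc.IH by (simp add: algebra_simps)
  finally show ?case
    by (simp only: jacobi_row.simps)
qed

lemma row_finite_mult_jacobi_matrix:
  assumes "i > 0"
  shows "row_finite_mult (jacobi_matrix s r) B i j = s i * B i j + B (Suc i) j + r i * B (i - 1) j"
proof -
  let ?A = "jacobi_matrix s r"
  have "row_finite_mult ?A B i j = (\<Sum>k\<in>{i - 1, i, Suc i}. ?A i k * B k j)"
    unfolding row_finite_mult_def
    by (rule sum.mono_neutral_left) (auto simp: jacobi_matrix_def split: if_splits)
  also have "\<dots> = s i * B i j + B (Suc i) j + r i * B (i - 1) j"
    using assms by (cases i) (auto simp: jacobi_matrix_def)
  finally show ?thesis .
qed

text \<open>A path of \<open>m \<le> i\<close> steps from row \<open>i\<close> does not go below row
  0. The boundary is thus invisible, and heights may be taken as integers relative to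
  \<open>n\<close>.\<close>

lemma row_finite_power_jacobi_matrix:
  assumes "m \<le> i"
  shows "row_finite_power (jacobi_matrix (\<lambda>i. s (int i - int n)) (\<lambda>i. r (int i - int n))) m i j
         = jacobi_row s r (int i - int n) m (int j - int n)"
  using assms
proof (induction m arbitrary: i)
  case 0
  show ?case by auto
next
  case (Suc m)
  then have "int (Suc i) - int n = int i - int n + 1" "int (i - 1) - int n = int i - int n - 1"
    and "i > 0" "m \<le> i" "m \<le> Suc i" "m \<le> i - 1"
    by auto
  then show ?case
    using Suc.IH by (simp only: jacobi_row_Suc_left row_finite_power.simps row_finite_mult_jacobi_matrix)
qed

definition mark_value :: "(nat \<Rightarrow> 'a) \<Rightarrow> (nat \<Rightarrow> 'a) \<Rightarrow> mark \<Rightarrow> 'a" where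
  "mark_value S R \<mu> = (if fst \<mu> then S (snd \<mu>) else R (snd \<mu>))"

definition weight :: "mark list \<Rightarrow> nat" where
  "weight ms = sum_list (map snd ms)"

text \<open>Terms with \<open>j = 0\<close> belong to the unmarked steps, so marks have positive
  order. Hence only finitely many lists have bounded weight.\<close>

definition mark_lists :: "mark list set" where
  "mark_lists = {ms. 0 \<notin> snd ` set ms}"

lemma length_le_weight: "ms \<in> mark_lists \<Longrightarrow> length ms \<le> weight ms"
proof (induction ms)
  case (Cons \<mu> ms)
  then show ?case
    by (cases "snd \<mu>") (auto simp: mark_lists_def weight_def)
qed (simp add: weight_def)

lemma finite_mark_lists: "finite {ms \<in> mark_lists. weight ms \<le> K}"
proof (rule finite_subset)
  show "{ms \<in> mark_lists. weight ms \<le> K} \<subseteq> {ms. set ms \<subseteq> UNIV \<times> {..K} \<and> length ms \<le> K}"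
  proof safe
    fix ms assume ms: "ms \<in> mark_lists" "weight ms \<le> K"
    show "length ms \<le> K"
      using length_le_weight[OF ms(1)] ms(2) by simp
    fix t k assume "(t, k) \<in> set ms"
    then have "k \<le> weight ms"
      unfolding weight_def by (intro member_le_sum_list) (auto intro: rev_image_eqI)
    with ms(2) show "k \<le> K"
      by simp
  qed auto
qed (intro finite_lists_length_le, auto)

lemma prod_list_mark_value_dvd:
  fixes S R :: "nat \<Rightarrow> real fps"
  assumes "\<And>j. fps_X ^ j dvd S j" "\<And>j. fps_X ^ j dvd R j"
  shows "fps_X ^ weight ms dvd prod_list (map (mark_value S R) ms)"
  using assms by (induction ms) (auto simp: weight_def power_add mark_value_def intro!: mult_dvd_mono)

lemma mark_op_sum: "mark_op \<mu> (\<lambda>c. \<Sum>a\<in>A. w a * f a c) c = (\<Sum>a\<in>A. w a * mark_op \<mu> (f a) c)"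
  by (simp add: mark_op_def Let_def sum_distrib_left mult.left_commute)

text \<open>Each step weight is split into its term \<open>j = 0\<close>, kept as an unmarked step,
  and its terms \<open>j > 0\<close>, recorded as marks. A list of marks contributes a multiple of
  \<open>fps_X ^ weight ms\<close>, so weights above \<open>K\<close> drop out.\<close>

lemma jacobi_row_agree_marked_paths:
  fixes S R :: "nat \<Rightarrow> real fps"
  assumes S: "\<And>j. fps_X ^ j dvd S j" and R: "\<And>j. fps_X ^ j dvd R j"
    and s: "\<And>k. agree K (s k) (\<Sum>j\<le>K. fps_const (of_int k ^ j / fact j) * S j)"
    and r: "\<And>k. agree K (r k) (\<Sum>j\<le>K. fps_const (of_int k ^ j / fact j) * R j)"
  shows "agree K (jacobi_row s r 0 m c)
    (\<Sum>ms | ms \<in> mark_lists \<and> weight ms \<le> K.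
       prod_list (map (mark_value S R) ms) * marked_paths ms m (S 0) (R 0) c)"
proof (induction m arbitrary: c)
  case 0
  let ?L = "{ms \<in> mark_lists. weight ms \<le> K}"
  have "(\<Sum>ms\<in>?L. prod_list (map (mark_value S R) ms) * marked_paths ms 0 (S 0) (R 0) c)
      = (\<Sum>ms\<in>{[]}. prod_list (map (mark_value S R) ms) * marked_paths ms 0 (S 0) (R 0) c)"
  proof (rule sum.mono_neutral_right)
    show "\<forall>ms\<in>?L - {[]}. prod_list (map (mark_value S R) ms) * marked_paths ms 0 (S 0) (R 0) c = 0"
      by (auto simp: neq_Nil_conv)
    show "finite ?L"
      by (rule finite_mark_lists)
  qed (auto simp: mark_lists_def weight_def)
  then show ?case
    by simp
next
  case (Suc m)
  let ?L = "{ms \<in> mark_lists. weight ms \<le> K}"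
  let ?w = "\<lambda>ms. prod_list (map (mark_value S R) ms)"
  let ?p = "\<lambda>ms. marked_paths ms m (S 0) (R 0)"
  define \<Phi> where "\<Phi> = (\<lambda>c. \<Sum>ms\<in>?L. ?w ms * ?p ms c)"
  define M :: "mark set" where "M = UNIV \<times> {1..K}"
  define t where "t = (\<lambda>(\<mu>, ms). mark_value S R \<mu> * (?w ms * mark_op \<mu> (?p ms) c))"
  have finM: "finite M" and finL: "finite ?L"
    by (simp_all add: M_def finite_mark_lists)
  \<comment> \<open>The contribution of the paths whose last step is marked, with that mark at the
    head of the list.\<close>
  define h where "h = (\<lambda>ms. case ms of [] \<Rightarrow> 0 | \<mu> # ms' \<Rightarrow> t (\<mu>, ms'))"
  have step: "?w ms * marked_paths ms (Suc m) (S 0) (R 0) c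
      = ?w ms * ?p ms (c - 1) + S 0 * (?w ms * ?p ms c) + R 0 * (?w ms * ?p ms (c + 1)) + h ms" for ms
    by (cases ms) (simp_all add: h_def t_def algebra_simps)
  have unmarked: "(\<Sum>ms\<in>?L. ?w ms * marked_paths ms (Suc m) (S 0) (R 0) c)
      = \<Phi> (c - 1) + S 0 * \<Phi> c + R 0 * \<Phi> (c + 1) + sum h ?L"
    unfolding step \<Phi>_def by (simp only: sum.distrib sum_distrib_left)
  \<comment> \<open>Prepending a mark of order at most \<open>K\<close> to a list in
    \<open>?L\<close> gives all nonempty lists of weight at most \<open>K\<close>, and heavier ones
    that vanish up to order \<open>K\<close>. Summing over the full rectangle of pairs makes the sum
    factor.\<close>
  have marked: "agree K (sum h ?L) (\<Sum>\<mu>\<in>M. mark_value S R \<mu> * mark_op \<mu> \<Phi> c)"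
  proof -
    let ?A = "{p \<in> M \<times> ?L. weight (fst p # snd p) \<le> K}"
    have "sum h ?L = sum h (?L - {[]})"
      by (rule sum.mono_neutral_right[OF finL]) (auto simp: h_def)
    also have "\<dots> = sum t ?A"
    proof (rule sum.reindex_bij_witness[of _ "\<lambda>p. fst p # snd p" "\<lambda>ms. (hd ms, tl ms)"])
      fix ms assume "ms \<in> ?L - {[]}"
      then obtain b k ms' where "ms = (b, k) # ms'" "ms \<in> mark_lists" "weight ms \<le> K"
        by (cases ms) auto
      then show "fst (hd ms, tl ms) # snd (hd ms, tl ms) = ms" "(hd ms, tl ms) \<in> ?A"
        "t (hd ms, tl ms) = h ms"
        by (auto simp: h_def M_def mark_lists_def weight_def image_iff)
    qed (auto simp: mark_lists_def weight_def M_def)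
    finally have "sum h ?L = sum t ?A" .
    moreover have "agree K (sum t (M \<times> ?L)) (sum t ?A)"
    proof (rule sum_agree_mono_neutral)
      fix p assume p: "p \<in> M \<times> ?L - ?A"
      then obtain \<mu> ms where \<mu>: "p = (\<mu>, ms)" "\<not> weight (\<mu> # ms) \<le> K"
        by auto
      have "fps_X ^ weight (\<mu> # ms) dvd t p"
        using dvd_mult2[OF prod_list_mark_value_dvd[OF S R, of "\<mu> # ms"], of "mark_op \<mu> (?p ms) c"] \<mu>(1)
        by (simp add: t_def mult.assoc)
      then show "agree K (t p) 0"
        using \<mu>(2) by (intro agree_0_if_dvd) auto
    qed (use finM finL in auto)
    moreover have "sum t (M \<times> ?L) = (\<Sum>\<mu>\<in>M. mark_value S R \<mu> * mark_op \<mu> \<Phi> c)"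
      unfolding \<Phi>_def mark_op_sum sum_distrib_left t_def by (simp add: sum.cartesian_product)
    ultimately show ?thesis
      by (simp add: agree_sym)
  qed
  have marks: "(\<Sum>\<mu>\<in>M. mark_value S R \<mu> * mark_op \<mu> \<Phi> c)
      = (\<Sum>j=1..K. fps_const (of_int c ^ j / fact j) * S j) * \<Phi> c
        + (\<Sum>j=1..K. fps_const (of_int (c + 1) ^ j / fact j) * R j) * \<Phi> (c + 1)"
    unfolding M_def sum.cartesian_product'
    by
      (simp add: UNIV_bool mark_value_def mark_op_def Let_def sum_distrib_left sum_distrib_right algebra_simps)
  have split: "(\<Sum>j\<le>K. fps_const (of_int k ^ j / fact j) * T j)
      = T 0 + (\<Sum>j=1..K. fps_const (of_int k ^ j / fact j) * T j)" for k :: int and T :: "nat \<Rightarrow> real fps"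
    by (subst atMost_atLeast0, subst sum.atLeast_Suc_atMost) simp_all
  have "agree K (\<Sum>ms\<in>?L. ?w ms * marked_paths ms (Suc m) (S 0) (R 0) c)
      (\<Phi> (c - 1) + S 0 * \<Phi> c + R 0 * \<Phi> (c + 1)
       + ((\<Sum>j=1..K. fps_const (of_int c ^ j / fact j) * S j) * \<Phi> c
        + (\<Sum>j=1..K. fps_const (of_int (c + 1) ^ j / fact j) * R j) * \<Phi> (c + 1)))"
    unfolding unmarked marks[symmetric] by (intro agree_add agree_refl marked)
  also have "(\<Phi> (c - 1) + S 0 * \<Phi> c + R 0 * \<Phi> (c + 1)
       + ((\<Sum>j=1..K. fps_const (of_int c ^ j / fact j) * S j) * \<Phi> c
        + (\<Sum>j=1..K. fps_const (of_int (c + 1) ^ j / fact j) * R j) * \<Phi> (c + 1)))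
     = \<Phi> (c - 1) + (\<Sum>j\<le>K. fps_const (of_int c ^ j / fact j) * S j) * \<Phi> c
        + (\<Sum>j\<le>K. fps_const (of_int (c + 1) ^ j / fact j) * R j) * \<Phi> (c + 1)"
    unfolding split by (simp only: distrib_right add.assoc add.left_commute add.commute)
  finally have "agree K (\<Sum>ms\<in>?L. ?w ms * marked_paths ms (Suc m) (S 0) (R 0) c)
     (\<Phi> (c - 1) + (\<Sum>j\<le>K. fps_const (of_int c ^ j / fact j) * S j) * \<Phi> c
        + (\<Sum>j\<le>K. fps_const (of_int (c + 1) ^ j / fact j) * R j) * \<Phi> (c + 1))" .
  moreover have "agree K (jacobi_row s r 0 m c) (\<Phi> c)" for c
    using Suc.IH by (simp add: \<Phi>_def)
  then have "agree K (jacobi_row s r 0 (Suc m) c)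
     (\<Phi> (c - 1) + (\<Sum>j\<le>K. fps_const (of_int c ^ j / fact j) * S j) * \<Phi> c
        + (\<Sum>j\<le>K. fps_const (of_int (c + 1) ^ j / fact j) * R j) * \<Phi> (c + 1))"
    unfolding jacobi_row.simps by (intro agree_add agree_mult s r)
  ultimately show ?case
    by (rule agree_trans[OF _ agree_sym, rotated])
qed

section \<open>Marked paths grouped by pairs of partitions\<close>

definition s_part :: "mark list \<Rightarrow> nat multiset" where
  "s_part ms = mset (map snd (filter fst ms))"

definition r_part :: "mark list \<Rightarrow> nat multiset" where
  "r_part ms = mset (map snd (filter (\<lambda>\<mu>. \<not> fst \<mu>) ms))"

definition lists_of_parts :: "nat multiset \<Rightarrow> nat multiset \<Rightarrow> mark list set" where
  "lists_of_parts p q = {ms. s_part ms = p \<and> r_part ms = q}"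

lemma weight_conv_parts: "weight ms = sum_mset (s_part ms) + sum_mset (r_part ms)"
  by (induction ms) (auto simp: weight_def s_part_def r_part_def)

lemma prod_list_mark_value:
  "prod_list (map (mark_value S R) ms) = (\<Prod>j\<in>#s_part ms. S j) * (\<Prod>j\<in>#r_part ms. R j :: 'a::comm_monoid_mult)"
  by (induction ms) (auto simp: mark_value_def s_part_def r_part_def ac_simps)

lemma mark_lists_iff: "ms \<in> mark_lists \<longleftrightarrow> (s_part ms, r_part ms) \<in> int_partitions \<times> int_partitions"
  by (force simp: mark_lists_def int_partitions_def s_part_def r_part_def)

lemma ex_list_of_parts: "\<exists>ms. s_part ms = p \<and> r_part ms = q"
proof -
  obtain ps qs where "mset ps = p" "mset qs = q"
    by (metis ex_mset)
  then have "s_part (map (Pair True) ps @ map (Pair False) qs) = p"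
    "r_part (map (Pair True) ps @ map (Pair False) qs) = q"
    by (simp_all add: s_part_def r_part_def filter_map comp_def)
  then show ?thesis
    by blast
qed

lemma finite_lists_of_parts:
  assumes "(p, q) \<in> int_partitions \<times> int_partitions"
  shows "finite (lists_of_parts p q)"
proof (rule finite_subset)
  show "lists_of_parts p q \<subseteq> {ms \<in> mark_lists. weight ms \<le> sum_mset p + sum_mset q}"
    using assms by (auto simp: lists_of_parts_def mark_lists_iff weight_conv_parts)
qed (rule finite_mark_lists)

lemma lists_of_parts_empty: "lists_of_parts {#} {#} = {[]}"
proof -
  have "ms = []" if "s_part ms = {#}" "r_part ms = {#}" for ms
    using that by (cases ms) (auto simp: s_part_def r_part_def split: if_splits)
  then show ?thesis
    by (auto simp: lists_of_parts_def s_part_def r_part_def)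
qed

lemma dn_partition_dvd: "fps_X ^ sum_mset p dvd dn_partition p f x"
  unfolding dn_partition_def
  by (induction p) (auto simp: power_add intro!: mult_dvd_mono dn_dvd)

lemma continuum_entry_conv_jacobi_row:
  assumes "n > degree V"
  shows "continuum_entry V u z x n n n' = (\<Sum>m\<le>degree (pderiv V). fps_const (coeff (pderiv V) m)
    * jacobi_row (\<lambda>k. index_shift k u x) (\<lambda>k. index_shift k (even_series z) x) 0 m (int n' - int n))"
proof -
  have deg: "degree (map_poly fps_const (pderiv V)) = degree (pderiv V)"
    by (rule degree_map_poly) simp
  have "degree (pderiv V) \<le> n"
    using assms degree_pderiv[of V] by simp
  then show ?thesis
    unfolding continuum_entry_def poly_of_matrix_def continuum_jacobi_def deg
    by (intro sum.cong refl)
      (simp add: coeff_map_poly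
        row_finite_power_jacobi_matrix[of _ _ "\<lambda>k. index_shift k u x" _ "\<lambda>k. index_shift k (even_series z) x"])
qed

text \<open>The product of derivatives depends only on the multisets of orders, the paths also on
  the sequence of the marks; so all lists with the same multisets are collected. The open column
  \<open>n'\<close> serves both string equations.\<close>

lemma has_sum_continuum_entry:
  fixes u z :: "nat \<Rightarrow> real \<Rightarrow> real"
  defines "\<sigma> x \<equiv> dn 0 u x" and "\<rho> x \<equiv> dn 0 (even_series z) x"
  assumes "n > degree V"
    and F: "\<And>p q. (p, q) \<in> int_partitions \<times> int_partitions \<Longrightarrow>
      F (p, q) = dn_partition p u x * dn_partition q (even_series z) x *
        (\<Sum>m\<le>degree (pderiv V). fps_const (coeff (pderiv V) m) *
          (\<Sum>ms\<in>lists_of_parts p q. marked_paths ms m (\<sigma> x) (\<rho> x) (int n' - int n)))"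
  shows "(F has_sum continuum_entry V u z x n n n') (int_partitions \<times> int_partitions)"
proof (rule has_sum_fpsI)
  fix K
  define L where "L = {ms \<in> mark_lists. weight ms \<le> K}"
  define g where "g ms = (s_part ms, r_part ms)" for ms
  define W where "W = pderiv V"
  define w where "w ms = prod_list (map (mark_value (\<lambda>j. dn j u x) (\<lambda>j. dn j (even_series z) x)) ms)" for ms
  let ?p = "\<lambda>ms m. marked_paths ms m (\<sigma> x) (\<rho> x) (int n' - int n)"
  have finL: "finite L"
    by (simp add: L_def finite_mark_lists)
  have lists: "lists_of_parts p q = {ms \<in> L. g ms = (p, q)}" if "(p, q) \<in> g ` L" for p q
    using that by (auto simp: lists_of_parts_def g_def L_def mark_lists_iff weight_conv_parts)
  have sub: "g ` L \<subseteq> int_partitions \<times> int_partitions"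
    by (auto simp: g_def L_def mark_lists_iff)
  have F': "F y = (\<Sum>ms | ms \<in> L \<and> g ms = y. w ms * (\<Sum>m\<le>degree W. fps_const (coeff W m) * ?p ms m))"
    if "y \<in> g ` L" for y
  proof -
    obtain p q where y: "y = (p, q)"
      by force
    have "w ms = dn_partition p u x * dn_partition q (even_series z) x" if "g ms = (p, q)" for ms
      using that by (simp add: w_def g_def prod_list_mark_value dn_partition_def)
    then have "(\<Sum>ms | ms \<in> L \<and> g ms = y. w ms * (\<Sum>m\<le>degree W. fps_const (coeff W m) * ?p ms m))
      = dn_partition p u x * dn_partition q (even_series z) x *
          (\<Sum>ms | ms \<in> L \<and> g ms = y. (\<Sum>m\<le>degree W. fps_const (coeff W m) * ?p ms m))"
      unfolding y sum_distrib_left[of _ _ "{ms. ms \<in> L \<and> g ms = (p, q)}"]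
      by (intro sum.cong refl) simp
    also have "(\<Sum>ms | ms \<in> L \<and> g ms = y. (\<Sum>m\<le>degree W. fps_const (coeff W m) * ?p ms m))
      = (\<Sum>m\<le>degree W. fps_const (coeff W m) * (\<Sum>ms\<in>lists_of_parts p q. ?p ms m))"
      unfolding sum_distrib_left y using that y lists by (subst sum.swap) simp
    finally show ?thesis
      using F[of p q] that sub y by (auto simp: W_def)
  qed
  have "sum F (g ` L) = (\<Sum>y\<in>g ` L. \<Sum>ms | ms \<in> L \<and> g ms = y.
      w ms * (\<Sum>m\<le>degree W. fps_const (coeff W m) * ?p ms m))"
    by (intro sum.cong refl F')
  also have "\<dots> = (\<Sum>ms\<in>L. w ms * (\<Sum>m\<le>degree W. fps_const (coeff W m) * ?p ms m))"
    using finL by (intro sum.group) auto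
  also have "\<dots> = (\<Sum>m\<le>degree W. fps_const (coeff W m) * (\<Sum>ms\<in>L. w ms * ?p ms m))"
    unfolding sum_distrib_left by (subst sum.swap) (simp only: mult.left_commute)
  finally have sum: "sum F (g ` L) = \<dots>" .
  have "agree K (continuum_entry V u z x n n n') (sum F (g ` L))"
    unfolding continuum_entry_conv_jacobi_row[OF assms(3)] sum unfolding W_def w_def L_def \<sigma>_def \<rho>_def
    by (intro agree_sum agree_mult agree_refl jacobi_row_agree_marked_paths agree_index_shift dn_dvd)
  moreover have "agree K (F y) 0" if "y \<in> int_partitions \<times> int_partitions - g ` L" for y
  proof -
    obtain p q where y: "y = (p, q)"
      by force
    obtain ms where ms: "g ms = y"
      using ex_list_of_parts y by (auto simp: g_def)
    then have "\<not> weight ms \<le> K"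
      using that by (auto simp: L_def g_def mark_lists_iff)
    then have K: "K < sum_mset p + sum_mset q"
      using ms y by (simp add: weight_conv_parts g_def)
    have "fps_X ^ (sum_mset p + sum_mset q) dvd dn_partition p u x * dn_partition q (even_series z) x"
      unfolding power_add by (intro mult_dvd_mono dn_partition_dvd)
    then have "fps_X ^ (sum_mset p + sum_mset q) dvd F y"
      using that F[of p q] y by (auto intro: dvd_mult2)
    then show ?thesis
      using K by (rule agree_0_if_dvd)
  qed
  ultimately show "\<exists>G. finite G \<and> G \<subseteq> int_partitions \<times> int_partitions
      \<and> agree K (sum F G) (continuum_entry V u z x n n n')
      \<and> (\<forall>y\<in>int_partitions \<times> int_partitions - G. agree K (F y) 0)"
    using finL sub by (intro exI[of _ "g ` L"]) (simp add: agree_sym)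
qed

context operator_class
begin

lemma string_expansion_a_exists:
  "\<exists>P. partition_indexed P \<and> (\<forall>p q. P p q \<in> S) \<and> string_expansion_a P"
proof -
  have "\<exists>P. represents P (\<lambda>m \<sigma> \<rho>. \<Sum>ms\<in>lists_of_parts p q. marked_paths ms m \<sigma> \<rho> 0)"
    if "(p, q) \<in> int_partitions \<times> int_partitions" for p q
    using represents_resolvent_span[OF marked_paths_in_resolvent_span]
    by (intro represents_sum finite_lists_of_parts that) simp
  then obtain P0 where P0: "\<And>p q. (p, q) \<in> int_partitions \<times> int_partitions \<Longrightarrow>
      represents (P0 p q) (\<lambda>m \<sigma> \<rho>. \<Sum>ms\<in>lists_of_parts p q. marked_paths ms m \<sigma> \<rho> 0)"
    by metis
  define P where "P p q = (if (p, q) \<in> int_partitions \<times> int_partitions then P0 p q else 0)" for p q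
  have "partition_indexed P"
    by (auto simp: partition_indexed_def P_def)
  moreover have "P p q \<in> S" for p q
    using P0[of p q] by (simp add: P_def represents_def zero_closed)
  moreover have "string_expansion_a P"
    unfolding string_expansion_a_def
  proof (intro allI impI)
    fix V u z x n
    assume "admissible V u z x" "degree V < n"
    then have "fps_nth (dn 0 (even_series z) x) 0 \<noteq> 0"
      by (simp add: admissible_def dn_def even_series_def)
    then show "(string_summand P (operand_a V) u z x has_sum continuum_entry V u z x n n n)
          (int_partitions \<times> int_partitions)"
      using P0 \<open>degree V < n\<close>
      by (intro has_sum_continuum_entry)
        (auto simp: string_summand_def operand_a_def P_def apply_op_central_coeff represents_def)
  qed
  ultimately show ?thesis
    by blast
qed

text \<open>With at least one mark, \<open>resolvent_span 1\<close> covers the index -1. Without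
  marks the order 0 does not reach this index, and the operand \<open>V\<close> in place of its
  derivative supplies the missing order.\<close>

lemma string_expansion_b_exists:
  "\<exists>P. partition_indexed P \<and> (\<forall>p q. P p q \<in> S) \<and> string_expansion_b P"
proof -
  define ne where "ne p q \<longleftrightarrow> (p, q) \<in> int_partitions \<times> int_partitions \<and> \<not> (p = {#} \<and> q = {#})" for p q
  have "\<exists>P. represents P (\<lambda>m \<sigma> \<rho>. \<Sum>ms\<in>lists_of_parts p q. marked_paths ms m \<sigma> \<rho> (- 1))"
    if pq: "ne p q" for p q
  proof (rule represents_sum)
    show "finite (lists_of_parts p q)"
      using pq by (simp add: ne_def finite_lists_of_parts)
    fix ms assume "ms \<in> lists_of_parts p q"
    then have "ms \<noteq> []"
      using pq by (auto simp: lists_of_parts_def ne_def s_part_def r_part_def)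
    then have "marked_paths ms \<in> resolvent_span 1"
      using marked_paths_Cons_in_resolvent_span[OF marked_paths_in_resolvent_span] by (cases ms) auto
    then show "\<exists>P. represents P (\<lambda>m \<sigma> \<rho>. marked_paths ms m \<sigma> \<rho> (- 1))"
      by (rule represents_resolvent_span) simp
  qed
  then obtain P1 where P1: "\<And>p q. ne p q \<Longrightarrow>
      represents (P1 p q) (\<lambda>m \<sigma> \<rho>. \<Sum>ms\<in>lists_of_parts p q. marked_paths ms m \<sigma> \<rho> (- 1))"
    by metis
  \<comment> \<open>The coefficient of \<open>1/h\<close> in the derivative of
    \<open>V(\<ell>)\<close> has order 1 and index -1; by reflection \<open>P0\<close> acts as
    \<open>r \<partial>\<^sub>r\<close>.\<close>
  obtain P0 where P0: "represents P0 (\<lambda>m \<sigma> \<rho>. dtri \<sigma> \<rho> 1 m (- 1))"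
    using represents_dtri_int[of "- 1" 1 1 0] by auto
  define P where "P p q = (if p = {#} \<and> q = {#} then P0 else if ne p q then P1 p q else 0)" for p q
  have "partition_indexed P"
    by (auto simp: partition_indexed_def P_def ne_def int_partitions_def)
  moreover have "P p q \<in> S" for p q
    using P0 P1[of p q] by (simp add: P_def represents_def zero_closed)
  moreover have "string_expansion_b P"
    unfolding string_expansion_b_def
  proof (intro allI impI)
    fix V u z x n
    assume adm: "admissible V u z x" and n: "degree V < n"
    define \<sigma> where "\<sigma> = dn 0 u x"
    define \<rho> where "\<rho> = dn 0 (even_series z) x"
    have \<rho>: "fps_nth \<rho> 0 \<noteq> 0"
      using adm by (simp add: admissible_def dn_def even_series_def \<rho>_def)
    have idx: "int (n - 1) - int n = - 1"
      using n by simp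
    \<comment> \<open>\<open>dtri \<sigma> \<rho> 1 m (- 1)\<close> has the factor \<open>m\<close>
      and belongs to the power \<open>m - 1\<close>; an index shift turns
      \<open>m * coeff V m\<close> into the coefficients of \<open>pderiv V\<close>.\<close>
    have empty: "apply_op P0 (central_coeff V) \<sigma> \<rho>
        = (\<Sum>m\<le>degree (pderiv V). fps_const (coeff (pderiv V) m) * tri \<sigma> \<rho> m (- 1))"
    proof (cases "degree V")
      case 0
      then have "pderiv V = 0"
        by (simp add: pderiv_eq_0_iff)
      with 0 P0 \<rho> show ?thesis
        by (simp add: apply_op_central_coeff represents_def dtri_eq_0)
    next
      case (Suc d)
      then have "degree (pderiv V) = d"
        by (simp add: degree_pderiv)
      with Suc P0 \<rho> show ?thesis
        by (simp add: apply_op_central_coeff represents_def dtri_eq_0 sum.atMost_Suc_shift coeff_pderiv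
            dtri_def mult_ac fps_of_nat[symmetric] del: of_nat_Suc sum.atMost_Suc flip: fps_const_mult)
    qed
    show "(string_summand P (operand_b V) u z x has_sum continuum_entry V u z x n n (n - 1))
          (int_partitions \<times> int_partitions)"
    proof (rule has_sum_continuum_entry[OF n], unfold idx)
      fix p q :: "nat multiset"
      assume pq: "(p, q) \<in> int_partitions \<times> int_partitions"
      show "string_summand P (operand_b V) u z x (p, q)
        = dn_partition p u x * dn_partition q (even_series z) x *
        (\<Sum>m\<le>degree (pderiv V). fps_const (coeff (pderiv V) m) *
          (\<Sum>ms\<in>lists_of_parts p q. marked_paths ms m (dn 0 u x) (dn 0 (even_series z) x) (- 1)))"
      proof (cases "p = {#} \<and> q = {#}")
        case True
        then show ?thesis
          using empty by (simp add: string_summand_def operand_b_def P_def lists_of_parts_empty \<sigma>_def \<rho>_def)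
      next
        case False
        then have "ne p q"
          using pq by (simp add: ne_def)
        then show ?thesis
          using P1[of p q] \<rho> False
          by (auto simp: string_summand_def operand_b_def P_def apply_op_central_coeff represents_def \<rho>_def)
      qed
    qed
  qed
  ultimately show ?thesis
    by blast
qed

end

section \<open>Polynomial coefficients and degree at most one\<close>

interpretation polynomial_ops: operator_class "{P. polynomial_coeffs P}"
proof
  show "0 \<in> {P. polynomial_coeffs P}"
    by (simp add: polynomial_coeffs_def)
next
  fix P Q assume "P \<in> {P. polynomial_coeffs P}" "Q \<in> {P. polynomial_coeffs P}"
  then show "P + Q \<in> {P. polynomial_coeffs P}"
    using keys_add by (fastforce simp: polynomial_coeffs_def)
next
  fix P b q assume "P \<in> {P. polynomial_coeffs P}"
  then show "smult [:Poly_Mapping.single (int b) q:] P \<in> {P. polynomial_coeffs P}"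
    using keys_mult[of "Poly_Mapping.single (int b) q"]
    by (fastforce simp: polynomial_coeffs_def split: if_splits)
next
  fix c j :: nat assume "c \<le> j"
  let ?P = "monom (monom (Poly_Mapping.single 0 (1 / fact j)) (j - c)) c :: diff_op"
  have "op_tri ?P m \<sigma> \<rho> = dtri \<sigma> \<rho> j m (int c)" for m \<sigma> \<rho>
    using \<open>c \<le> j\<close> by (rule op_tri_monom_inverse_fact)
  moreover have "polynomial_coeffs ?P"
    by (simp add: polynomial_coeffs_def)
  ultimately show "\<exists>P\<in>{P. polynomial_coeffs P}. \<forall>m \<sigma> \<rho>. fps_nth \<rho> 0 \<noteq> 0 \<longrightarrow>
      op_tri P m \<sigma> \<rho> = dtri \<sigma> \<rho> j m (int c)"
    by blast
qed

text \<open>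
  Integration by parts gives \<open>r h\<^sup>-\<^sup>c\<^sup>-\<^sup>1 G'(\<ell>) = h\<^sup>-\<^sup>c\<^sup>+\<^sup>1 G'(\<ell>) - c h\<^sup>-\<^sup>c G(\<ell>)\<close> up to terms without \<open>h\<^sup>0\<close>; for
  \<open>c = 1\<close> this is \<open>r \<partial>\<^sub>r\<^sup>2 = \<partial>\<^sub>s\<^sup>2 - \<partial>\<^sub>r\<close>.
\<close>

lemma dtri_degree_le_1:
  assumes "c \<le> j"
  shows "\<exists>P. degree P \<le> 1 \<and> (\<forall>m \<sigma> \<rho>. fps_nth \<rho> 0 \<noteq> 0 \<longrightarrow> op_tri P m \<sigma> \<rho> = dtri \<sigma> \<rho> j m (int c))"
  using assms
proof (induction c arbitrary: j rule: less_induct)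
  case (less c)
  show ?case
  proof (cases "c \<le> 1")
    case True
    let ?P = "monom (monom (Poly_Mapping.single 0 (1 / fact j)) (j - c)) c :: diff_op"
    have "op_tri ?P m \<sigma> \<rho> = dtri \<sigma> \<rho> j m (int c)" for m \<sigma> \<rho>
      using less.prems by (rule op_tri_monom_inverse_fact)
    moreover have "degree ?P \<le> 1"
      using degree_monom_le order_trans True by blast
    ultimately show ?thesis
      by blast
  next
    case False
    then obtain d i where d: "c = Suc (Suc d)" and i: "j = Suc i" "Suc d \<le> i"
      using less.prems by (metis Suc_le_D Suc_le_mono not_less_eq_eq One_nat_def)
    obtain P where P: "degree P \<le> 1"
      "\<And>m \<sigma> \<rho>. fps_nth \<rho> 0 \<noteq> 0 \<Longrightarrow> op_tri P m \<sigma> \<rho> = dtri \<sigma> \<rho> j m (int d)"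
      using less.IH[of d j] less.prems d by auto
    obtain Q where Q: "degree Q \<le> 1"
      "\<And>m \<sigma> \<rho>. fps_nth \<rho> 0 \<noteq> 0 \<Longrightarrow> op_tri Q m \<sigma> \<rho> = dtri \<sigma> \<rho> i m (int (Suc d))"
      using less.IH[of "Suc d" i] i d by auto
    \<comment> \<open>The equation \<open>dtri_index\<close> of order \<open>i\<close> at the index
      \<open>Suc d\<close> is solved for its last term, \<open>\<rho>\<close> times the wanted one;
      dividing by \<open>\<rho>\<close> produces the exponents -1.\<close>
    let ?q = "- of_nat (Suc d) / of_nat (Suc i) :: rat"
    let ?R = "smult [:Poly_Mapping.single (- 1) 1:] P + smult [:Poly_Mapping.single (- 1) ?q:] Q"
    have "degree ?R \<le> 1"
      using P(1) Q(1) by (intro degree_add_le order_trans[OF degree_smult_le])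
    moreover have "op_tri ?R m \<sigma> \<rho> = dtri \<sigma> \<rho> j m (int c)" if \<rho>: "fps_nth \<rho> 0 \<noteq> 0" for m \<sigma> \<rho>
    proof -
      have inv: "\<rho> powi (- 1) * \<rho> = 1"
        using \<rho> by (simp add: power_int_def inverse_mult_eq_1)
      have rat: "of_rat ?q = - (of_nat (Suc d) / of_nat (Suc i) :: real)"
        by (simp add: of_rat_divide of_rat_minus del: of_nat_Suc)
      have nat: "fps_const (- (of_nat (Suc d) / of_nat (Suc i))) * of_nat (Suc i) = (- of_nat (Suc d) :: real fps)"
        by (simp flip: fps_of_nat del: of_nat_Suc)
      have idx: "of_nat (Suc d) * dtri \<sigma> \<rho> i m (int (Suc d))
          = of_nat (Suc i) * (dtri \<sigma> \<rho> j m (int d) - \<rho> * dtri \<sigma> \<rho> j m (int c))"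
        using dtri_index[of "int (Suc d)" \<sigma> \<rho> i m] d i by (simp add: add.commute)
      have "of_nat (Suc i) * (dtri \<sigma> \<rho> j m (int d)
            + fps_const (- (of_nat (Suc d) / of_nat (Suc i))) * dtri \<sigma> \<rho> i m (int (Suc d)))
          = of_nat (Suc i) * dtri \<sigma> \<rho> j m (int d)
            + (fps_const (- (of_nat (Suc d) / of_nat (Suc i))) * of_nat (Suc i)) * dtri \<sigma> \<rho> i m (int (Suc d))"
        by (simp only: distrib_left mult_ac)
      also have "\<dots> = of_nat (Suc i) * (\<rho> * dtri \<sigma> \<rho> j m (int c))"
        unfolding nat using idx by (simp add: algebra_simps)
      finally have "dtri \<sigma> \<rho> j m (int d)
            + fps_const (- (of_nat (Suc d) / of_nat (Suc i))) * dtri \<sigma> \<rho> i m (int (Suc d))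
          = \<rho> * dtri \<sigma> \<rho> j m (int c)"
        by (simp del: of_nat_Suc)
      then have "\<rho> powi (- 1) * (dtri \<sigma> \<rho> j m (int d)
            + fps_const (- (of_nat (Suc d) / of_nat (Suc i))) * dtri \<sigma> \<rho> i m (int (Suc d)))
          = dtri \<sigma> \<rho> j m (int c)"
        by (simp only: mult.assoc[symmetric] inv mult_1_left)
      then show ?thesis
        unfolding op_tri_add op_tri_smult[OF \<rho>] P(2)[OF \<rho>] Q(2)[OF \<rho>] rat
        by (simp add: distrib_left mult_ac)
    qed
    ultimately show ?thesis
      by blast
  qed
qed

interpretation degree_le_1_ops: operator_class "{P. degree P \<le> 1}"
proof
  fix P Q :: diff_op and b q
  assume P: "P \<in> {P. degree P \<le> 1}"
  then show "smult [:Poly_Mapping.single (int b) q:] P \<in> {P. degree P \<le> 1}"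
    using order_trans[OF degree_smult_le] by simp
  assume "Q \<in> {P. degree P \<le> 1}"
  with P show "P + Q \<in> {P. degree P \<le> 1}"
    by (simp add: degree_add_le)
qed (use dtri_degree_le_1 in auto)

section \<open>Uniqueness\<close>

text \<open>Dedekind's independence of characters: subtracting \<open>\<phi> a v\<close> times the
  relation from its translate by \<open>v\<close> removes the term \<open>a\<close> and multiplies
  the others by \<open>\<phi> j v - \<phi> a v\<close>. It serves both for powers of
  \<open>r\<close> and for monomials in the jets.\<close>

lemma characters_independent:
  fixes \<phi> :: "'i \<Rightarrow> 'm \<Rightarrow> 'a::idom" and op2 :: "'m \<Rightarrow> 'm \<Rightarrow> 'm"
  assumes "finite A"
    and closed: "\<And>x y. x \<in> C \<Longrightarrow> y \<in> C \<Longrightarrow> op2 x y \<in> C"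
    and mult: "\<And>i x y. x \<in> C \<Longrightarrow> y \<in> C \<Longrightarrow> \<phi> i (op2 x y) = \<phi> i x * \<phi> i y"
    and nonzero: "\<And>i. i \<in> A \<Longrightarrow> \<exists>x\<in>C. \<phi> i x \<noteq> 0"
    and separate: "\<And>i j. i \<in> A \<Longrightarrow> j \<in> A \<Longrightarrow> i \<noteq> j \<Longrightarrow> \<exists>x\<in>C. \<phi> i x \<noteq> \<phi> j x"
    and zero: "\<And>x. x \<in> C \<Longrightarrow> (\<Sum>i\<in>A. c i * \<phi> i x) = 0"
    and "i \<in> A"
  shows "c i = 0"
proof -
  have "\<forall>i\<in>B. c i = 0" if "finite B" "B \<subseteq> A" "\<And>x. x \<in> C \<Longrightarrow> (\<Sum>i\<in>B. c i * \<phi> i x) = 0" for B c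
    using that
  proof (induction B arbitrary: c)
    case (insert a B)
    have "c i = 0" if "i \<in> B" for i
    proof -
      have "i \<in> A" "a \<in> A" "i \<noteq> a"
        using insert.hyps insert.prems that by auto
      then obtain v where v: "v \<in> C" "\<phi> i v \<noteq> \<phi> a v"
        using separate by blast
      have "(\<Sum>j\<in>B. (c j * (\<phi> j v - \<phi> a v)) * \<phi> j x) = 0" if "x \<in> C" for x
      proof -
        have "(\<Sum>j\<in>B. (c j * (\<phi> j v - \<phi> a v)) * \<phi> j x) = (\<Sum>j\<in>insert a B. (c j * (\<phi> j v - \<phi> a v)) * \<phi> j x)"
          using insert.hyps by simp
        also have "\<dots> = (\<Sum>j\<in>insert a B. c j * \<phi> j (op2 v x)) - \<phi> a v * (\<Sum>j\<in>insert a B. c j * \<phi> j x)"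
          unfolding sum_distrib_left sum_subtractf[symmetric]
          using v that by (intro sum.cong refl) (simp add: mult algebra_simps)
        also have "\<dots> = 0"
          using insert.prems(2)[of x] insert.prems(2)[of "op2 v x"] that v closed by simp
        finally show ?thesis .
      qed
      then have "\<forall>j\<in>B. c j * (\<phi> j v - \<phi> a v) = 0"
        using insert.prems by (intro insert.IH) auto
      with \<open>i \<in> B\<close> v show ?thesis
        by auto
    qed
    moreover have "c a = 0"
    proof -
      obtain x where x: "x \<in> C" "\<phi> a x \<noteq> 0"
        using nonzero[of a] insert.prems(1) by auto
      have "(\<Sum>j\<in>insert a B. c j * \<phi> j x) = c a * \<phi> a x"
        using insert.hyps calculation by simp
      with insert.prems(2)[OF x(1)] x show ?thesis
        by simp
    qed
    ultimately show ?case
      by simp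
  qed simp
  with assms show ?thesis
    by blast
qed

definition laurent_real :: "(int \<Rightarrow>\<^sub>0 rat) \<Rightarrow> real \<Rightarrow> real" where
  "laurent_real c r = (\<Sum>k\<in>Poly_Mapping.keys c. of_rat (Poly_Mapping.lookup c k) * r powi k)"

text \<open>On the positive reals the powers of \<open>r\<close> are multiplicative, and
  \<open>r = 2\<close> separates them.\<close>

lemma laurent_real_eq_0_imp:
  assumes "\<And>r. r > 0 \<Longrightarrow> laurent_real c r = 0"
  shows "c = 0"
proof (rule ccontr)
  assume "c \<noteq> 0"
  then obtain k where k: "k \<in> Poly_Mapping.keys c"
    by (metis keys_eq_empty equals0I)
  have "(of_rat (Poly_Mapping.lookup c k) :: real) = 0"
  proof (rule characters_independent[of "Poly_Mapping.keys c" "{0::real<..}" "(*)" "\<lambda>k r. r powi k"])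
    fix i j :: int assume "i \<noteq> j"
    then have "(2::real) powi i \<noteq> 2 powi j"
      by (metis less_irrefl linorder_neqE_linordered_idom one_less_numeral_iff power_int_strict_increasing semiring_norm(76))
    then show "\<exists>r\<in>{0::real<..}. r powi i \<noteq> r powi j"
      by (intro bexI[of _ 2]) auto
  next
    fix i :: int
    show "\<exists>r\<in>{0::real<..}. r powi i \<noteq> 0"
      by (intro bexI[of _ 1]) auto
  qed (use k assms in \<open>auto simp: laurent_real_def power_int_mult_distrib\<close>)
  with k show False
    by (simp add: in_keys_iff)
qed

lemma fps_const_sum: "fps_const (sum f A) = (\<Sum>a\<in>A. fps_const (f a :: real))"
  by (induction A rule: infinite_finite_induct) (simp_all flip: fps_const_add)

lemma laurent_eval_fps_const: "r > 0 \<Longrightarrow> laurent_eval c (fps_const r) = fps_const (laurent_real c r)"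
proof -
  assume "r > 0"
  then have "fps_const r powi k = fps_const (r powi k)" for k
    by (simp add: power_int_def fps_const_power fps_const_inverse)
  then show ?thesis
    by (simp add: laurent_eval_def laurent_real_def fps_const_sum)
qed

lemma tri_fps_const: "tri (fps_const s) (fps_const r) m c = fps_const (tri s r m c)"
  by (induction m arbitrary: c) auto

text \<open>The operator on the \<open>m\<close>-th power, evaluated at \<open>s = 0\<close> and a
  real \<open>r\<close>. These values will determine an operator of degree at most one.\<close>

definition op_real :: "diff_op \<Rightarrow> nat \<Rightarrow> real \<Rightarrow> real" where
  "op_real P m r = (\<Sum>b\<le>m. \<Sum>a\<le>m. laurent_real (coeff (coeff P b) a) r
                      * (fact (a + b) * dtri 0 r (a + b) m (int b)))"

lemma op_tri_fps_const: "r > 0 \<Longrightarrow> op_tri P m 0 (fps_const r) = fps_const (op_real P m r)"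
proof -
  have "dtri 0 (fps_const r) j m c = fps_const (dtri 0 r j m c)" for j c
    using tri_fps_const[of 0 r] by (simp add: dtri_def fps_of_nat[symmetric])
  moreover have "(fact j :: real fps) = fps_const (fact j)" for j
    by (metis fps_of_nat of_nat_fact)
  moreover assume "r > 0"
  ultimately show ?thesis
    by (simp add: op_tri_def op_real_def laurent_eval_fps_const fps_const_sum)
qed

lemma tri_eq_0: "int m < \<bar>c\<bar> \<Longrightarrow> tri s r m c = 0"
  by (induction m arbitrary: c) auto

lemma tri_0_odd: "odd (int m + c) \<Longrightarrow> tri 0 r m c = 0"
  by (induction m arbitrary: c) auto

text \<open>At \<open>s = 0\<close> only up and down steps remain; \<open>a\<close> of the former
  and \<open>b\<close> of the latter have \<open>(a + b) choose b\<close> arrangements, each of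
  weight \<open>r ^ b\<close>.\<close>

lemma tri_0: "tri 0 r (a + b) (int a - int b) = of_nat ((a + b) choose b) * r ^ b"
proof (induction "a + b" arbitrary: a b)
  case (Suc n)
  have step: "tri 0 r (a + b) (int a - int b) = tri 0 r n (int a - int b - 1) + r * tri 0 r n (int a - int b + 1)"
    unfolding Suc.hyps(2)[symmetric] by simp
  show ?case
  proof (cases a; cases b)
    fix a' b' assume ab: "a = Suc a'" "b = Suc b'"
    have "tri 0 r n (int a - int b - 1) = of_nat (n choose b) * r ^ b"
      using Suc.hyps(1)[of a' b] Suc.hyps(2) ab by (simp add: algebra_simps)
    moreover have "tri 0 r n (int a - int b + 1) = of_nat (n choose b') * r ^ b'"
      using Suc.hyps(1)[of a b'] Suc.hyps(2) ab by (simp add: algebra_simps)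
    ultimately show ?thesis
      unfolding step using ab Suc.hyps(2) by (simp add: algebra_simps flip: Suc.hyps(2))
  next
    fix a' assume ab: "a = Suc a'" "b = 0"
    then have "tri 0 r n (int a - int b + 1) = 0"
      using Suc.hyps(2) by (intro tri_eq_0) auto
    moreover have "tri 0 r n (int a - int b - 1) = 1"
      using Suc.hyps(1)[of a' 0] Suc.hyps(2) ab by simp
    ultimately show ?thesis
      unfolding step using ab by simp
  next
    fix b' assume ab: "a = 0" "b = Suc b'"
    then have "tri 0 r n (int a - int b - 1) = 0"
      using Suc.hyps(2) by (intro tri_eq_0) auto
    moreover have "tri 0 r n (int a - int b + 1) = r ^ b'"
      using Suc.hyps(1)[of 0 b'] Suc.hyps(2) ab by (simp add: algebra_simps)
    ultimately show ?thesis
      unfolding step using ab by simp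
  qed (use Suc.hyps in auto)
qed simp

lemma fact_mult_choose: "k \<le> n \<Longrightarrow> fact k * of_nat (n choose k) = (fact n / fact (n - k) :: real)"
  by (simp add: binomial_fact)

lemma fact_mult_dtri_0:
  "m = a + 2 * k \<Longrightarrow> fact a * dtri 0 r a m 0 = fact m * r ^ k / (fact k)\<^sup>2" for r :: real
proof -
  assume m: "m = a + 2 * k"
  have "tri 0 r (2 * k) 0 = fact (2 * k) / (fact k * fact k) * r ^ k"
    using tri_0[of r k k] by (simp add: binomial_fact mult_2)
  then show ?thesis
    using fact_mult_choose[of a m] m by (simp add: dtri_def mult.assoc[symmetric] power2_eq_square)
qed

text \<open>The derivative in \<open>r\<close> of the value in \<open>fact_mult_dtri_0\<close>,
  written as that value times \<open>k/r\<close>; in this form \<open>k = 0\<close> is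
  included.\<close>

lemma fact_mult_dtri_1:
  "m = a + 2 * k \<Longrightarrow> r \<noteq> 0 \<Longrightarrow>
    fact (Suc a) * dtri 0 r (Suc a) m 1 = fact m * r ^ k / (fact k)\<^sup>2 * (of_nat k / r)" for r :: real
proof (cases k)
  case (Suc l)
  assume m: "m = a + 2 * k" and "r \<noteq> 0"
  have "m - Suc a = Suc l + l"
    using m Suc by simp
  moreover have "tri 0 r (Suc l + l) 1 = fact (Suc l + l) / (fact l * fact (Suc l)) * r ^ l"
    using tri_0[of r "Suc l" l] by (simp add: binomial_fact)
  ultimately have tri: "tri 0 r (m - Suc a) 1 = fact (m - Suc a) / (fact l * fact (Suc l)) * r ^ l"
    by simp
  have "fact (Suc a) * dtri 0 r (Suc a) m 1 = (fact (Suc a) * of_nat (m choose Suc a)) * tri 0 r (m - Suc a) 1"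
    by (simp only: dtri_def mult.assoc)
  also have "\<dots> = fact m / fact (m - Suc a) * tri 0 r (m - Suc a) 1"
    using m Suc by (subst fact_mult_choose) auto
  also have "\<dots> = fact m / (fact l * fact (Suc l)) * r ^ l"
    unfolding tri by simp
  finally have "fact (Suc a) * dtri 0 r (Suc a) m 1 = fact m / (fact l * fact (Suc l)) * r ^ l" .
  moreover define x :: real where "x = of_nat (Suc l)"
  then have "x \<noteq> 0" "fact (Suc l) = x * fact l"
    by simp_all
  ultimately show ?thesis
    using Suc \<open>r \<noteq> 0\<close> unfolding Suc x_def[symmetric]
    by (simp add: power2_eq_square del: fact_Suc)
qed (simp add: dtri_eq_0)

lemma op_real_eq:
  assumes "degree P \<le> 1" "1 \<le> m" "r > 0"
  shows "op_real P m r = fact m * (\<Sum>a | a \<le> m \<and> even (m - a).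
    r ^ ((m - a) div 2) / (fact ((m - a) div 2))\<^sup>2 *
      (laurent_real (coeff (coeff P 0) a) r
       + laurent_real (coeff (coeff P 1) a) r * (of_nat ((m - a) div 2) / r)))"
proof -
  define f where "f a = laurent_real (coeff (coeff P 0) a) r * (fact a * dtri 0 r a m 0)
     + laurent_real (coeff (coeff P 1) a) r * (fact (Suc a) * dtri 0 r (Suc a) m 1)" for a
  let ?g = "\<lambda>b a. laurent_real (coeff (coeff P b) a) r * (fact (a + b) * dtri 0 r (a + b) m (int b))"
  have "op_real P m r = (\<Sum>b\<le>m. \<Sum>a\<le>m. ?g b a)"
    by (simp add: op_real_def)
  also have "\<dots> = (\<Sum>b\<in>{0, 1}. \<Sum>a\<le>m. ?g b a)"
    using assms by (intro sum.mono_neutral_right) (auto simp: coeff_eq_0 laurent_real_def)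
  also have "\<dots> = (\<Sum>a\<le>m. f a)"
    by (simp add: f_def sum.distrib)
  also have "\<dots> = (\<Sum>a | a \<le> m \<and> even (m - a). f a)"
  proof (rule sum.mono_neutral_right)
    show "\<forall>a\<in>{..m} - {a. a \<le> m \<and> even (m - a)}. f a = 0"
    proof
      fix a assume a: "a \<in> {..m} - {a. a \<le> m \<and> even (m - a)}"
      then have "tri 0 r (m - a) 0 = 0" "tri 0 r (m - Suc a) 1 = 0"
        by (auto intro!: tri_0_odd elim!: oddE)
      then show "f a = 0"
        by (simp add: f_def dtri_def)
    qed
  qed auto
  also have "\<dots> = (\<Sum>a | a \<le> m \<and> even (m - a). fact m * (r ^ ((m - a) div 2) / (fact ((m - a) div 2))\<^sup>2 *
      (laurent_real (coeff (coeff P 0) a) r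
       + laurent_real (coeff (coeff P 1) a) r * (of_nat ((m - a) div 2) / r))))"
  proof (intro sum.cong refl)
    fix a assume "a \<in> {a. a \<le> m \<and> even (m - a)}"
    then have m: "m = a + 2 * ((m - a) div 2)"
      by auto
    have "r \<noteq> 0"
      using assms by simp
    show "f a = fact m * (r ^ ((m - a) div 2) / (fact ((m - a) div 2))\<^sup>2 *
      (laurent_real (coeff (coeff P 0) a) r
       + laurent_real (coeff (coeff P 1) a) r * (of_nat ((m - a) div 2) / r)))"
      unfolding f_def fact_mult_dtri_0[OF m] fact_mult_dtri_1[OF m \<open>r \<noteq> 0\<close>] by (simp add: algebra_simps)
  qed
  finally show ?thesis
    by (simp add: sum_distrib_left)
qed

text \<open>The falling factorial \<open>x (x - 1) ... (x - i + 1)\<close>.\<close>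

definition falling :: "nat \<Rightarrow> real poly" where
  "falling i = (\<Prod>l<i. [:- of_nat l, 1:])"

lemma falling_Suc: "falling (Suc i) = falling i * [:- of_nat i, 1:]"
  by (simp add: falling_def mult.commute)

lemma falling_monic: "degree (falling i) = i" "coeff (falling i) i = 1"
proof -
  have "degree (falling i) = i \<and> lead_coeff (falling i) = 1"
  proof (induction i)
    case (Suc i)
    then have "falling i \<noteq> 0"
      by auto
    with Suc show ?case
      unfolding falling_Suc by (subst degree_mult_eq) (auto simp: lead_coeff_mult simp del: mult_pCons_right)
  qed (simp add: falling_def)
  then show "degree (falling i) = i" "coeff (falling i) i = 1"
    by auto
qed

lemma poly_falling: "poly (falling i) (of_nat n) = (if i \<le> n then fact n / fact (n - i) else 0)"
proof (induction i)
  case (Suc i)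
  show ?case
  proof (cases "i < n")
    case True
    then obtain k where k: "n - i = Suc k" "n - Suc i = k"
      by (metis Suc_diff_Suc)
    then have diff: "real n - real i = real (Suc k)"
      using True by linarith
    have "poly (falling (Suc i)) (real n) = poly (falling i) (real n) * (real n - real i)"
      by (simp add: falling_Suc algebra_simps)
    then show ?thesis
      using Suc k True unfolding diff by (simp del: of_nat_Suc)
  next
    case False
    with Suc show ?thesis
      by (cases "i = n") (simp_all add: falling_Suc)
  qed
qed (simp add: falling_def)

text \<open>The products are monic of the distinct degrees \<open>2 i\<close> and
  \<open>2 i + 1\<close>, so the coefficients vanish from the top down.\<close>

lemma falling_independent:
  assumes "(\<Sum>i<N. smult (a i) (falling i * falling i) + smult (b i) (falling i * falling (Suc i))) = 0"
    and "i < N"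
  shows "a i = 0 \<and> b i = 0"
  using assms
proof (induction N)
  case (Suc N)
  let ?t = "\<lambda>i. smult (a i) (falling i * falling i) + smult (b i) (falling i * falling (Suc i))"
  have deg: "degree (falling i * falling j) = i + j" for i j
    by (metis coeff_0 degree_mult_eq falling_monic zero_neq_one)
  have coeff: "coeff (falling i * falling j) (i + j) = 1" for i j
    using coeff_mult_degree_sum[of "falling i" "falling j"] by (simp add: falling_monic)
  have low: "coeff (\<Sum>i<N. ?t i) n = 0" if "2 * N \<le> n" for n
  proof -
    have "coeff (?t i) n = 0" if "i < N" for i
      using \<open>2 * N \<le> n\<close> that deg[of i i] deg[of i "Suc i"] by (simp add: coeff_eq_0)
    then show ?thesis
      by (simp add: coeff_sum)
  qed
  have "coeff (\<Sum>i<Suc N. ?t i) (N + Suc N) = b N"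
    using low[of "N + Suc N"] coeff[of N "Suc N"] deg[of N N] by (simp add: coeff_eq_0)
  with Suc.prems have b: "b N = 0"
    by simp
  have "coeff (\<Sum>i<Suc N. ?t i) (N + N) = a N"
    using low[of "N + N"] coeff[of N N] b by simp
  with Suc.prems have a: "a N = 0"
    by simp
  have "(\<Sum>i<N. ?t i) = 0"
    using Suc.prems a b by simp
  with Suc.IH Suc.prems a b show ?case
    by (cases "i = N") auto
qed simp

text \<open>
  On the powers \<open>\<lambda>\<^sup>m\<close> with \<open>m = 2M + \<epsilon>\<close>, at \<open>s = 0\<close>, the operators \<open>\<partial>\<^sub>s\<^sup>a\<close> and \<open>\<partial>\<^sub>s\<^sup>a \<partial>\<^sub>r\<close> with \<open>a = 2i + \<epsilon>\<close> give,
  up to common factors, the polynomials \<open>(M)\<^sub>i\<^sup>2\<close> and \<open>(M)\<^sub>i (M)\<^sub>i\<^sub>+\<^sub>1\<close> in \<open>M\<close>, whose degrees are all different.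
\<close>

lemma op_real_injective:
  assumes "degree P \<le> 1" and zero: "\<And>m r. 1 \<le> m \<Longrightarrow> r > 0 \<Longrightarrow> op_real P m r = 0"
  shows "P = 0"
proof -
  have "laurent_real (coeff (coeff P 0) j) r = 0 \<and> laurent_real (coeff (coeff P 1) j) r = 0" if r: "r > 0" for j r
  proof -
    \<comment> \<open>At \<open>s = 0\<close> only the \<open>\<partial>\<^sub>s\<close>-orders with
      the parity of \<open>m\<close> contribute, so the parity of \<open>j\<close> is fixed and
      \<open>m = 2 * M + \<epsilon>\<close> varies with \<open>M\<close>.\<close>
    define \<epsilon> where "\<epsilon> = j mod 2"
    define \<alpha> where "\<alpha> i = laurent_real (coeff (coeff P 0) (2 * i + \<epsilon>)) r" for i
    define \<beta> where "\<beta> i = laurent_real (coeff (coeff P 1) (2 * i + \<epsilon>)) r" for i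
    define N where "N = Suc (j + degree (coeff P 0) + degree (coeff P 1))"
    have out: "\<alpha> i = 0 \<and> \<beta> i = 0" if "N \<le> i" for i
      using that by (auto simp: \<alpha>_def \<beta>_def N_def coeff_eq_0 laurent_real_def)
    define Q where "Q = (\<Sum>i<N. smult (\<alpha> i / r ^ i) (falling i * falling i)
        + smult (\<beta> i / r ^ Suc i) (falling i * falling (Suc i)))"
    have "poly Q (of_nat M) = 0" if "1 \<le> M" for M
    proof -
      let ?F = "\<lambda>i. r ^ (M - i) / (fact (M - i))\<^sup>2 * (\<alpha> i + \<beta> i * (of_nat (M - i) / r))"
      let ?m = "2 * M + \<epsilon>"
      have "{a. a \<le> ?m \<and> even (?m - a)} = (\<lambda>i. 2 * i + \<epsilon>) ` {..M}"
      proof (intro equalityI subsetI)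
        fix a assume a: "a \<in> {a. a \<le> ?m \<and> even (?m - a)}"
        have "\<epsilon> \<le> 1"
          by (simp add: \<epsilon>_def)
        then have "a = 2 * ((a - \<epsilon>) div 2) + \<epsilon>" "(a - \<epsilon>) div 2 \<le> M"
          using a by (auto elim!: evenE; presburger)+
        then show "a \<in> (\<lambda>i. 2 * i + \<epsilon>) ` {..M}"
          by (intro image_eqI[of _ _ "(a - \<epsilon>) div 2"]) auto
      qed auto
      moreover have "inj_on (\<lambda>i. 2 * i + \<epsilon>) {..M}"
        by (auto simp: inj_on_def)
      ultimately have "op_real P ?m r = fact ?m * (\<Sum>i\<le>M. ?F i)"
        using op_real_eq[OF assms(1), of ?m r] that r
        by (simp add: sum.reindex \<alpha>_def \<beta>_def flip: diff_mult_distrib2)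
      then have F0: "(\<Sum>i\<le>M. ?F i) = 0"
        using zero[of ?m r] that r by simp
      \<comment> \<open>The common factor turns the factorials of \<open>M - i\<close> into falling
        factorials at \<open>M\<close>, which makes each term polynomial in
        \<open>M\<close>.\<close>
      have "(fact M)\<^sup>2 / r ^ M * ?F i = poly (smult (\<alpha> i / r ^ i) (falling i * falling i)
        + smult (\<beta> i / r ^ Suc i) (falling i * falling (Suc i))) (of_nat M)" if "i \<le> M" for i
      proof -
        define e g :: real where "e = of_nat (M - i)" and "g = fact (M - i)"
        have ff: "poly (falling (Suc i)) (of_nat M) = e * poly (falling i) (of_nat M)"
          using that by (simp add: e_def falling_Suc of_nat_diff algebra_simps)
        have rM: "r ^ M = r ^ i * r ^ (M - i)"
          using that by (simp flip: power_add)
        have f: "poly (falling i) (of_nat M) = fact M / g"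
          using that by (simp add: g_def poly_falling)
        have "g \<noteq> 0"
          by (simp add: g_def)
        then show ?thesis
          unfolding e_def[symmetric] g_def[symmetric] poly_add poly_smult poly_mult ff f rM
          using r by (simp add: power2_eq_square field_simps)
      qed
      then have "(fact M)\<^sup>2 / r ^ M * (\<Sum>i\<le>M. ?F i) = (\<Sum>i\<le>M. poly (smult (\<alpha> i / r ^ i) (falling i * falling i)
        + smult (\<beta> i / r ^ Suc i) (falling i * falling (Suc i))) (of_nat M))"
        unfolding sum_distrib_left by (intro sum.cong) auto
      \<comment> \<open>\<open>falling i\<close> vanishes at \<open>M\<close> for
        \<open>i > M\<close>, and \<open>\<alpha>\<close>, \<open>\<beta>\<close> vanish from
        \<open>N\<close> on, so the range becomes independent of \<open>M\<close>.\<close>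
      also have "\<dots> = (\<Sum>i<N + Suc M. poly (smult (\<alpha> i / r ^ i) (falling i * falling i)
        + smult (\<beta> i / r ^ Suc i) (falling i * falling (Suc i))) (of_nat M))"
        by (intro sum.mono_neutral_left) (auto simp: poly_falling simp del: of_nat_Suc)
      also have "\<dots> = poly Q (of_nat M)"
        unfolding Q_def poly_sum by (intro sum.mono_neutral_right) (use out in auto)
      finally show ?thesis
        unfolding F0 by simp
    qed
    then have "(of_nat ` {1..} :: real set) \<subseteq> {y. poly Q y = 0}"
      by auto
    moreover have "infinite (of_nat ` {1::nat..} :: real set)"
      by (simp add: finite_image_iff infinite_Ici)
    ultimately have "Q = 0"
      using poly_roots_finite finite_subset by blast
    moreover have "j div 2 < N"
      by (simp add: N_def)
    ultimately have "\<alpha> (j div 2) / r ^ (j div 2) = 0 \<and> \<beta> (j div 2) / r ^ Suc (j div 2) = 0"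
      unfolding Q_def by (rule falling_independent)
    then show ?thesis
      using r by (simp add: \<alpha>_def \<beta>_def \<epsilon>_def)
  qed
  then have "coeff (coeff P 0) j = 0" "coeff (coeff P 1) j = 0" for j
    by (auto intro!: laurent_real_eq_0_imp)
  then have "coeff P 0 = 0" "coeff P 1 = 0"
    by (auto intro!: poly_eqI)
  show ?thesis
  proof (rule poly_eqI)
    fix b
    show "coeff P b = coeff 0 b"
    proof (cases "b \<le> 1")
      case True
      then have "b = 0 \<or> b = 1"
        by auto
      with \<open>coeff P 0 = 0\<close> \<open>coeff P 1 = 0\<close> show ?thesis
        by auto
    next
      case False
      with assms(1) show ?thesis
        by (simp add: coeff_eq_0)
    qed
  qed
qed

section \<open>Polynomial test functions with prescribed jets\<close>

lemma funpow_deriv_poly: "(deriv ^^ m) (poly p) = poly ((pderiv ^^ m) p)" for p :: "real poly"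
proof (induction m)
  case (Suc m)
  then show ?case
    by (auto intro!: ext DERIV_imp_deriv poly_DERIV)
qed simp

lemma poly_higher_pderiv_0: "poly ((pderiv ^^ m) p) 0 = fact m * coeff p m" for p :: "real poly"
  using coeff_higher_pderiv[of m p 0] by (simp add: poly_0_coeff_0 pochhammer_fact)

lemma dn_poly:
  "dn m (\<lambda>j. poly (if j = 0 then p else 0)) 0 = fps_X ^ m * fps_const (fact m * coeff p m)"
proof -
  have "Abs_fps (\<lambda>j. (deriv ^^ m) (poly (if j = 0 then p else 0)) 0) = fps_const (fact m * coeff p m)"
    by (rule fps_ext) (auto simp: funpow_deriv_poly poly_higher_pderiv_0)
  then show ?thesis
    unfolding dn_def by (rule arg_cong)
qed

lemma even_series_poly:
  "even_series (\<lambda>j. poly (if j = 0 then p else 0)) = (\<lambda>j. poly (if j = 0 then p else 0))"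
  by (auto simp: even_series_def fun_eq_iff)

text \<open>With a single nonzero coefficient function, a partition contributes at one power of
  \<open>1/N\<close> only, its total size. A fixed power thus isolates finitely many pairs.\<close>

lemma dn_partition_poly:
  "dn_partition q (\<lambda>j. poly (if j = 0 then p else 0)) 0
   = fps_X ^ sum_mset q * fps_const (\<Prod>m\<in>#q. fact m * coeff p m)"
  by (induction q) (simp_all add: dn_partition_def dn_poly power_add mult_ac flip: fps_const_mult)

lemma monom_conv_potential:
  assumes "k > 0"
  shows "\<exists>d t. monom 1 k = potential d t"
proof -
  \<comment> \<open>The second term cancels the fixed quadratic part of the potential.\<close>
  define t :: "nat \<Rightarrow> real" where "t j = (if j = k then 1 else 0) - (if j = 2 then 1 / 2 else 0)" for j
  have "coeff (potential (k + 2) t) n = coeff (monom 1 k) n" for n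
  proof -
    have "coeff (\<Sum>j=1..k + 2. monom (t j) j) n = (\<Sum>j=1..k + 2. if n = j then t j else 0)"
      by (auto simp: coeff_sum intro!: sum.cong)
    also have "\<dots> = (if n \<in> {1..k + 2} then t n else 0)"
      by (simp add: sum.delta)
    finally show ?thesis
      using assms by (auto simp: potential_def t_def)
  qed
  then have "monom 1 k = potential (k + 2) t"
    by (intro poly_eqI) simp
  then show ?thesis
    by blast
qed

lemma admissible_poly:
  assumes "k > 0" "coeff q 0 \<noteq> 0"
  shows "admissible (monom 1 k) (\<lambda>g. poly (if g = 0 then p else 0)) (\<lambda>g. poly (if g = 0 then q else 0)) 0"
  unfolding admissible_def
proof (intro conjI exI[of _ UNIV] allI ballI)
  have "poly a differentiable at y" for a :: "real poly" and y
    by (simp add: field_differentiable_imp_differentiable poly_DERIV field_differentiable_def real_differentiable_def)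
      (use poly_DERIV in blast)
  then show "(deriv ^^ m) (poly (if g = 0 then p else 0)) differentiable at y"
    "(deriv ^^ m) (poly (if g = 0 then q else 0)) differentiable at y" for g m and y :: real
    by (simp_all only: funpow_deriv_poly)
qed (use assms monom_conv_potential in \<open>auto simp: poly_0_coeff_0\<close>)

lemma finite_partitions_of_weight:
  "finite {(p, q). (p, q) \<in> int_partitions \<times> int_partitions \<and> sum_mset p + sum_mset q = w}"
proof (rule finite_subset)
  show "{(p, q). (p, q) \<in> int_partitions \<times> int_partitions \<and> sum_mset p + sum_mset q = w}
     \<subseteq> (\<lambda>ms. (s_part ms, r_part ms)) ` {ms \<in> mark_lists. weight ms \<le> w}"
  proof clarify
    fix p q assume pq: "p \<in> int_partitions" "q \<in> int_partitions" "w = sum_mset p + sum_mset q"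
    obtain ms where "s_part ms = p" "r_part ms = q"
      using ex_list_of_parts by blast
    with pq show "(p, q) \<in> (\<lambda>ms. (s_part ms, r_part ms)) `
        {ms \<in> mark_lists. weight ms \<le> sum_mset p + sum_mset q}"
      by (intro image_eqI[of _ _ ms]) (auto simp: mark_lists_iff weight_conv_parts)
  qed
qed (simp add: finite_mark_lists)

text \<open>Monomials are multiplicative under pointwise products of their arguments. Setting one
  variable to 2 and the others to 1 reads off its exponent, so distinct monomials are distinct
  characters.\<close>

lemma monomials_independent:
  fixes d :: "nat multiset \<times> nat multiset \<Rightarrow> real"
  assumes "finite A" "(p, q) \<in> A"
    and "\<And>U Z. (\<Sum>(p, q)\<in>A. d (p, q) * ((\<Prod>m\<in>#p. U m) * (\<Prod>m\<in>#q. Z m))) = 0"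
  shows "d (p, q) = 0"
proof (rule characters_independent[of A UNIV "\<lambda>x y. (\<lambda>m. fst x m * fst y m, \<lambda>m. snd x m * snd y m)"
    "\<lambda>(p, q) (U, Z). (\<Prod>m\<in>#p. U m) * (\<Prod>m\<in>#q. Z m)"])
  fix i j :: "nat multiset \<times> nat multiset"
  assume "i \<noteq> j"
  obtain p q p' q' where ij: "i = (p, q)" "j = (p', q')"
    by (metis prod.exhaust)
  have pow: "(\<Prod>m\<in>#p. if m = a then 2 else 1 :: real) = 2 ^ count p a" for p and a :: nat
    by (induction p) auto
  have "\<exists>a. count p a \<noteq> count p' a \<or> count q a \<noteq> count q' a"
    using \<open>i \<noteq> j\<close> ij by (auto simp: multiset_eq_iff)
  then consider a where "count p a \<noteq> count p' a" | a where "count q a \<noteq> count q' a"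
    by blast
  then show "\<exists>x\<in>UNIV. (case i of (p, q) \<Rightarrow> \<lambda>(U, Z). (\<Prod>m\<in>#p. U m) * (\<Prod>m\<in>#q. Z m :: real)) x
      \<noteq> (case j of (p, q) \<Rightarrow> \<lambda>(U, Z). (\<Prod>m\<in>#p. U m) * (\<Prod>m\<in>#q. Z m)) x"
  proof cases
    case (1 a)
    then show ?thesis
      by (intro bexI[of _ "(\<lambda>m. if m = a then 2 else 1, \<lambda>m. 1)"]) (simp_all add: ij pow)
  next
    case (2 a)
    then show ?thesis
      by (intro bexI[of _ "(\<lambda>m. 1, \<lambda>m. if m = a then 2 else 1)"]) (simp_all add: ij pow)
  qed
next
  fix i :: "nat multiset \<times> nat multiset"
  show "\<exists>x\<in>UNIV. (case i of (p, q) \<Rightarrow> \<lambda>(U, Z). (\<Prod>m\<in>#p. U m) * (\<Prod>m\<in>#q. Z m :: real)) x \<noteq> 0"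
    by (intro bexI[of _ "(\<lambda>m. 1, \<lambda>m. 1)"]) (auto split: prod.splits)
qed (use assms in \<open>auto simp: prod_mset.distrib case_prod_beta mult_ac\<close>)

definition apply_real :: "diff_op \<Rightarrow> real poly \<Rightarrow> real \<Rightarrow> real" where
  "apply_real P W r = (\<Sum>m\<le>degree W. coeff W m * op_real P m r)"

lemma apply_op_fps_const:
  "r > 0 \<Longrightarrow> apply_op P (central_coeff W) 0 (fps_const r) = fps_const (apply_real P W r)"
  by (simp add: apply_op_central_coeff op_tri_fps_const apply_real_def fps_const_sum)

lemma laurent_real_diff: "laurent_real (c - d) r = laurent_real c r - laurent_real d r"
proof -
  let ?A = "Poly_Mapping.keys c \<union> Poly_Mapping.keys d"
  have "laurent_real e r = (\<Sum>k\<in>?A. of_rat (Poly_Mapping.lookup e k) * r powi k)"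
    if "Poly_Mapping.keys e \<subseteq> ?A" for e
    unfolding laurent_real_def using that by (intro sum.mono_neutral_left) (auto simp: in_keys_iff)
  from this[of c] this[of d] this[of "c - d"] show ?thesis
    using keys_diff[of c d]
    by (simp add: lookup_minus of_rat_diff left_diff_distrib sum_subtractf)
qed

lemma op_real_diff: "op_real (P - Q) m r = op_real P m r - op_real Q m r"
  by (simp add: op_real_def laurent_real_diff left_diff_distrib sum_subtractf)

text \<open>
  Polynomial functions \<open>u\<^sub>0\<close>, \<open>z\<^sub>0\<close> with arbitrary jets at \<open>0\<close>, all other \<open>u\<^sub>g\<close> and \<open>z\<^sub>g\<close> being \<open>0\<close>, separate the
  pairs of partitions, and the potentials \<open>\<lambda>\<^sup>k\<close> then determine the operators.
\<close>

lemma string_family_unique: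
  fixes P P' :: op_family and B :: "nat multiset \<Rightarrow> nat multiset \<Rightarrow> bool"
  defines "G V p q \<equiv> central_coeff (if B p q then V else pderiv V)"
  assumes indexed: "partition_indexed P" "partition_indexed P'"
    and degree: "\<And>p q. degree (P p q) \<le> 1" "\<And>p q. degree (P' p q) \<le> 1"
    and same: "\<And>V u z x. admissible V u z x \<Longrightarrow> \<exists>l.
      (string_summand P (G V) u z x has_sum l) (int_partitions \<times> int_partitions) \<and>
      (string_summand P' (G V) u z x has_sum l) (int_partitions \<times> int_partitions)"
  shows "P = P'"
proof (intro ext)
  fix p0 q0
  show "P p0 q0 = P' p0 q0"
  proof (cases "(p0, q0) \<in> int_partitions \<times> int_partitions")
    case False
    with indexed show ?thesis
      by (simp add: partition_indexed_def)
  next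
    case True
    define w where "w = sum_mset p0 + sum_mset q0"
    define A where "A = {(p, q). (p, q) \<in> int_partitions \<times> int_partitions \<and> sum_mset p + sum_mset q = w}"
    have finA: "finite A"
      unfolding A_def by (rule finite_partitions_of_weight)
    have p0: "(p0, q0) \<in> A"
      using True by (simp add: A_def w_def)
    have key: "apply_real (P p0 q0) (if B p0 q0 then monom 1 k else pderiv (monom 1 k)) r
        = apply_real (P' p0 q0) (if B p0 q0 then monom 1 k else pderiv (monom 1 k)) r"
      if "k > 0" "r > 0" for k r
    proof -
      define V where "V = (monom 1 k :: real poly)"
      define W where "W p q = (if B p q then V else pderiv V)" for p q
      define d where "d = (\<lambda>(p, q). apply_real (P p q) (W p q) r - apply_real (P' p q) (W p q) r)"
      have "d (p0, q0) = 0"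
      proof (rule monomials_independent[OF finA p0])
        fix U Z :: "nat \<Rightarrow> real"
        \<comment> \<open>The derivatives of orders 1 to \<open>w\<close> at 0 are prescribed by
          \<open>F\<close>. The constant terms, 0 for \<open>s\<close> and \<open>r\<close> for
          \<open>r\<close>, make the operators act at \<open>s = 0\<close> and a constant
          \<open>r\<close>.\<close>
        define jet where "jet F c = Poly (c # map (\<lambda>j. F j / fact j) [1..<Suc w])" for F :: "nat \<Rightarrow> real" and c
        have jet0: "coeff (jet F c) 0 = c" for F c
          by (simp add: jet_def)
        have jet: "fact m * coeff (jet F c) m = F m" if "0 < m" "m \<le> w" for F c m
          using that by (cases m) (auto simp: jet_def nth_default_def simp del: upt_Suc)
        let ?u = "\<lambda>g. poly (if g = 0 then jet U 0 else 0)"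
        let ?z = "\<lambda>g. poly (if g = 0 then jet Z r else 0)"
        have "admissible V ?u ?z 0"
          unfolding V_def using that by (intro admissible_poly) (auto simp: jet0)
        then obtain l where l:
          "(string_summand P (G V) ?u ?z 0 has_sum l) (int_partitions \<times> int_partitions)"
          "(string_summand P' (G V) ?u ?z 0 has_sum l) (int_partitions \<times> int_partitions)"
          using same by blast
        have summand: "string_summand R (G V) ?u ?z 0 (p, q)
          = fps_X ^ (sum_mset p + sum_mset q) * fps_const ((\<Prod>m\<in>#p. fact m * coeff (jet U 0) m)
              * (\<Prod>m\<in>#q. fact m * coeff (jet Z r) m) * apply_real (R p q) (W p q) r)" for R p q
        proof -
          have "dn 0 ?u 0 = 0" "dn 0 ?z 0 = fps_const r"
            by (simp_all add: dn_poly jet0)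
          then show ?thesis
            unfolding string_summand_def even_series_poly dn_partition_poly G_def W_def[symmetric]
            using apply_op_fps_const[OF \<open>r > 0\<close>, of "R p q" "W p q"]
            by (simp add: power_add mult_ac flip: fps_const_mult)
        qed
        have nth: "fps_nth (string_summand R (G V) ?u ?z 0 (p, q)) w
          = (if (p, q) \<in> A then (\<Prod>m\<in>#p. U m) * (\<Prod>m\<in>#q. Z m) * apply_real (R p q) (W p q) r else 0)"
          if pq: "(p, q) \<in> int_partitions \<times> int_partitions" for R p q
        proof (cases "(p, q) \<in> A")
          case True
          then have w: "sum_mset p + sum_mset q = w"
            by (simp add: A_def)
          have le: "m \<le> w" if "m \<in># p \<or> m \<in># q" for m
            using that w by (auto dest!: multi_member_split)
          have "(\<Prod>m\<in>#p. fact m * coeff (jet U 0) m) = (\<Prod>m\<in>#p. U m)"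
            using pq le by (intro arg_cong[of _ _ prod_mset] image_mset_cong jet) (auto simp: int_partitions_def intro!: gr0I)
          moreover have "(\<Prod>m\<in>#q. fact m * coeff (jet Z r) m) = (\<Prod>m\<in>#q. Z m)"
            using pq le by (intro arg_cong[of _ _ prod_mset] image_mset_cong jet) (auto simp: int_partitions_def intro!: gr0I)
          ultimately show ?thesis
            using True unfolding summand w by (simp add: fps_X_power_mult_nth)
        next
          case False
          then have "sum_mset p + sum_mset q \<noteq> w"
            using pq by (simp add: A_def)
          with False show ?thesis
            unfolding summand by (simp add: fps_X_power_mult_nth)
        qed
        \<comment> \<open>For both families the coefficient \<open>w\<close> of the partial sums
          stabilises; a finite \<open>H\<close> beyond both thresholds and containing
          \<open>A\<close> allows comparing them, and only pairs in \<open>A\<close>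
          contribute.\<close>
        have "\<forall>\<^sub>F F in finite_subsets_at_top (int_partitions \<times> int_partitions).
            fps_nth (sum (string_summand P (G V) ?u ?z 0) F) w = fps_nth l w"
          "\<forall>\<^sub>F F in finite_subsets_at_top (int_partitions \<times> int_partitions).
            fps_nth (sum (string_summand P' (G V) ?u ?z 0) F) w = fps_nth l w"
          using l by (simp_all add: has_sum_def tendsto_fps_iff)
        then obtain F F' where F: "finite F" "F \<subseteq> int_partitions \<times> int_partitions"
          "\<And>H. finite H \<Longrightarrow> F \<subseteq> H \<Longrightarrow> H \<subseteq> int_partitions \<times> int_partitions \<Longrightarrow>
             fps_nth (sum (string_summand P (G V) ?u ?z 0) H) w = fps_nth l w"
          and F': "finite F'" "F' \<subseteq> int_partitions \<times> int_partitions"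
          "\<And>H. finite H \<Longrightarrow> F' \<subseteq> H \<Longrightarrow> H \<subseteq> int_partitions \<times> int_partitions \<Longrightarrow>
             fps_nth (sum (string_summand P' (G V) ?u ?z 0) H) w = fps_nth l w"
          unfolding eventually_finite_subsets_at_top by auto
        define H where "H = F \<union> F' \<union> A"
        have H: "finite H" "A \<subseteq> H" "H \<subseteq> int_partitions \<times> int_partitions" "F \<subseteq> H" "F' \<subseteq> H"
          using F F' finA by (auto simp: H_def A_def)
        have sumH: "fps_nth (sum (string_summand R (G V) ?u ?z 0) H) w
          = (\<Sum>(p, q)\<in>A. (\<Prod>m\<in>#p. U m) * (\<Prod>m\<in>#q. Z m) * apply_real (R p q) (W p q) r)" for R
        proof -
          have "fps_nth (sum (string_summand R (G V) ?u ?z 0) H) w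
            = (\<Sum>y\<in>A. fps_nth (string_summand R (G V) ?u ?z 0 y) w)"
            unfolding fps_sum_nth
          proof (rule sum.mono_neutral_right)
            show "\<forall>y\<in>H - A. fps_nth (string_summand R (G V) ?u ?z 0 y) w = 0"
            proof
              fix y assume y: "y \<in> H - A"
              obtain p q where "y = (p, q)"
                by force
              with y H(3) show "fps_nth (string_summand R (G V) ?u ?z 0 y) w = 0"
                using nth[of p q R] by auto
            qed
          qed (use H in auto)
          also have "\<dots> = (\<Sum>(p, q)\<in>A. (\<Prod>m\<in>#p. U m) * (\<Prod>m\<in>#q. Z m) * apply_real (R p q) (W p q) r)"
          proof (rule sum.cong[OF refl])
            fix y assume y: "y \<in> A"
            obtain p q where "y = (p, q)"
              by force
            with y show "fps_nth (string_summand R (G V) ?u ?z 0 y) w = (case y of (p, q) \<Rightarrow>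
                (\<Prod>m\<in>#p. U m) * (\<Prod>m\<in>#q. Z m) * apply_real (R p q) (W p q) r)"
              using nth[of p q R] by (simp add: A_def)
          qed
          finally show ?thesis .
        qed
        have "(\<Sum>(p, q)\<in>A. d (p, q) * ((\<Prod>m\<in>#p. U m) * (\<Prod>m\<in>#q. Z m)))
          = (\<Sum>(p, q)\<in>A. (\<Prod>m\<in>#p. U m) * (\<Prod>m\<in>#q. Z m) * apply_real (P p q) (W p q) r)
            - (\<Sum>(p, q)\<in>A. (\<Prod>m\<in>#p. U m) * (\<Prod>m\<in>#q. Z m) * apply_real (P' p q) (W p q) r)"
          unfolding sum_subtractf[symmetric] by (intro sum.cong) (auto simp: d_def algebra_simps)
        also have "\<dots> = 0"
          using sumH[of P] sumH[of P'] F(3)[of H] F'(3)[of H] H by simp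
        finally show "(\<Sum>(p, q)\<in>A. d (p, q) * ((\<Prod>m\<in>#p. U m) * (\<Prod>m\<in>#q. Z m))) = 0" .
      qed
      then show ?thesis
        unfolding d_def W_def V_def by simp
    qed
    have "op_real (P p0 q0 - P' p0 q0) m r = 0" if "1 \<le> m" "r > 0" for m r
    proof -
      have monom: "apply_real R (monom c n) r = c * op_real R n r" if "c \<noteq> 0" for R c n
      proof -
        have "apply_real R (monom c n) r = (\<Sum>i\<le>n. if i = n then c * op_real R n r else 0)"
          unfolding apply_real_def degree_monom_eq[OF that] by (intro sum.cong refl) auto
        then show ?thesis
          by simp
      qed
      show ?thesis
      proof (cases "B p0 q0")
        case True
        with key[of m r] that monom[of 1] show ?thesis
          by (simp add: op_real_diff)
      next
        \<comment> \<open>The operand is the derivative here, so \<open>V\<close> is the power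
          \<open>Suc m\<close>, and the nonzero factor \<open>Suc m\<close> cancels.\<close>
        case False
        with key[of "Suc m" r] that monom[of "of_nat (Suc m)"] show ?thesis
          by (simp add: op_real_diff pderiv_monom del: of_nat_Suc)
      qed
    qed
    then have "P p0 q0 - P' p0 q0 = 0"
      using degree by (intro op_real_injective degree_diff_le) auto
    then show ?thesis
      by simp
  qed
qed

lemma string_expansion_a_unique:
  assumes "partition_indexed P" "\<And>p q. degree (P p q) \<le> 1" "string_expansion_a P"
    and "partition_indexed P'" "\<And>p q. degree (P' p q) \<le> 1" "string_expansion_a P'"
  shows "P = P'"
proof (rule string_family_unique[where B = "\<lambda>_ _. False"])
  fix V u z x assume "admissible V u z x"
  moreover have "operand_a V = (\<lambda>p q. central_coeff (if False then V else pderiv V))"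
    by (simp add: fun_eq_iff operand_a_def)
  ultimately show "\<exists>l.
      (string_summand P (\<lambda>p q. central_coeff (if False then V else pderiv V)) u z x has_sum l)
        (int_partitions \<times> int_partitions) \<and>
      (string_summand P' (\<lambda>p q. central_coeff (if False then V else pderiv V)) u z x has_sum l)
        (int_partitions \<times> int_partitions)"
    using assms(3,6) unfolding string_expansion_a_def by (metis lessI)
qed (use assms in auto)

lemma string_expansion_b_unique:
  assumes "partition_indexed P" "\<And>p q. degree (P p q) \<le> 1" "string_expansion_b P"
    and "partition_indexed P'" "\<And>p q. degree (P' p q) \<le> 1" "string_expansion_b P'"
  shows "P = P'"
proof (rule string_family_unique[where B = "\<lambda>p q. p = {#} \<and> q = {#}"])
  fix V u z x assume "admissible V u z x"
  moreover have "operand_b V = (\<lambda>p q. central_coeff (if p = {#} \<and> q = {#} then V else pderiv V))"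
    by (simp add: fun_eq_iff operand_b_def)
  ultimately show "\<exists>l.
      (string_summand P (\<lambda>p q. central_coeff (if p = {#} \<and> q = {#} then V else pderiv V)) u z x has_sum l)
        (int_partitions \<times> int_partitions) \<and>
      (string_summand P' (\<lambda>p q. central_coeff (if p = {#} \<and> q = {#} then V else pderiv V)) u z x has_sum l)
        (int_partitions \<times> int_partitions)"
    using assms(3,6) unfolding string_expansion_b_def by (metis lessI)
qed (use assms in auto)

text \<open>Infinite sums are unique, so prescribing the sum amounts to prescribing the matrix
  entry. As the sums do not involve \<open>n\<close>, the value \<open>Suc (degree V)\<close> stands
  for all larger ones.\<close>

lemma continuum_string_equations_iff:
  assumes "string_expansion_a Pa" "string_expansion_b Pb" "admissible V u z x"
  shows "continuum_string_equations V u z x \<longleftrightarrow>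
           (string_summand Pa (operand_a V) u z x has_sum 0) (int_partitions \<times> int_partitions)
         \<and> (string_summand Pb (operand_b V) u z x has_sum fps_const x) (int_partitions \<times> int_partitions)"
proof -
  have a: "(string_summand Pa (operand_a V) u z x has_sum continuum_entry V u z x n n n)
      (int_partitions \<times> int_partitions)"
    and b: "(string_summand Pb (operand_b V) u z x has_sum continuum_entry V u z x n n (n - 1))
      (int_partitions \<times> int_partitions)" if "n > degree V" for n
    using assms that by (auto simp: string_expansion_a_def string_expansion_b_def)
  show ?thesis
  proof
    assume "continuum_string_equations V u z x"
    then have "0 = continuum_entry V u z x (Suc (degree V)) (Suc (degree V)) (Suc (degree V))"
      "fps_const x = continuum_entry V u z x (Suc (degree V)) (Suc (degree V)) (Suc (degree V) - 1)"
      unfolding continuum_string_equations_def using lessI by blast+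
    then show "(string_summand Pa (operand_a V) u z x has_sum 0) (int_partitions \<times> int_partitions)
         \<and> (string_summand Pb (operand_b V) u z x has_sum fps_const x) (int_partitions \<times> int_partitions)"
      using a[OF lessI] b[OF lessI] by (simp only:)
  next
    assume "(string_summand Pa (operand_a V) u z x has_sum 0) (int_partitions \<times> int_partitions)
         \<and> (string_summand Pb (operand_b V) u z x has_sum fps_const x) (int_partitions \<times> int_partitions)"
    then have "0 = continuum_entry V u z x n n n" "fps_const x = continuum_entry V u z x n n (n - 1)"
      if "n > degree V" for n
      using infsumI[OF a[OF that]] infsumI[OF b[OF that]] by (auto dest: infsumI)
    then show "continuum_string_equations V u z x"
      unfolding continuum_string_equations_def by simp
  qed
qed

theorem theorem1:
  shows
    "(\<exists>Pa Pb. partition_indexed Pa \<and> partition_indexed Pb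
        \<and> (\<forall>p q. polynomial_coeffs (Pa p q) \<and> polynomial_coeffs (Pb p q))
        \<and> string_expansion_a Pa \<and> string_expansion_b Pb)
   \<and> (\<exists>!Pa. partition_indexed Pa \<and> (\<forall>p q. degree (Pa p q) \<le> 1) \<and> string_expansion_a Pa)
   \<and> (\<exists>!Pb. partition_indexed Pb \<and> (\<forall>p q. degree (Pb p q) \<le> 1) \<and> string_expansion_b Pb)
   \<and> (\<forall>Pa Pb V u z x. string_expansion_a Pa \<and> string_expansion_b Pb \<and> admissible V u z x \<longrightarrow>
        (continuum_string_equations V u z x \<longleftrightarrow>
           (string_summand Pa (operand_a V) u z x has_sum 0) (int_partitions \<times> int_partitions)
         \<and> (string_summand Pb (operand_b V) u z x has_sum fps_const x) (int_partitions \<times> int_partitions)))"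
proof (intro conjI)
  show "\<exists>Pa Pb. partition_indexed Pa \<and> partition_indexed Pb
        \<and> (\<forall>p q. polynomial_coeffs (Pa p q) \<and> polynomial_coeffs (Pb p q))
        \<and> string_expansion_a Pa \<and> string_expansion_b Pb"
    using polynomial_ops.string_expansion_a_exists polynomial_ops.string_expansion_b_exists
    by (metis mem_Collect_eq)
  show "\<exists>!Pa. partition_indexed Pa \<and> (\<forall>p q. degree (Pa p q) \<le> 1) \<and> string_expansion_a Pa"
    using degree_le_1_ops.string_expansion_a_exists string_expansion_a_unique by auto
  show "\<exists>!Pb. partition_indexed Pb \<and> (\<forall>p q. degree (Pb p q) \<le> 1) \<and> string_expansion_b Pb"
    using degree_le_1_ops.string_expansion_b_exists string_expansion_b_unique by auto
qed (intro allI impI, elim conjE, rule continuum_string_equations_iff)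

end
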